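(* Let $k\ge 3$ be an integer and let $\gamma\subset\mathbb{R}^2$ be a $C^2$-smooth, planar, strictly convex closed curve which is invariant under the rotation $R_{2\pi/k}$. If the Birkhoff billiard map inside $\gamma$ has a rotational invariant curve of $k$-periodic orbits, then $\gamma$ is a circle.
   Context: $R_\theta$ denotes the rotation of $\mathbb{R}^2$ by angle $\theta$ about the origin. Birkhoff billiard map: a point moves along straight lines inside $\gamma$ and reflects at $\gamma$ by the law "angle of incidence equals angle of reflection". The phase space is the open cylinder of oriented lines intersecting the interior of $\gamma$, with coordinates $(s,\alpha)$, where $s$ is the arc length parameter of the first intersection point of the line with $\gamma$ and $\alpha\in(0,\pi)$ is the angle between the line and $\dot\gamma(s)$. The billiard map $T$ sends an oriented line to the oriented line obtained after reflection at its second intersection point with $\gamma$; it is the twist map with generating function $L(s,s')=|\gamma(s)-\gamma(s')|$. A rotational invariant curve is a simple closed curve in the phase cylinder, homotopically non-trivial (winding once around the cylinder), that is mapped to itself by $T$. It is a rotational invariant curve of $k$-periodic orbits if all its points are periodic for $T$ with (minimal) period $k$; its rotation number is then of the form $r/k$ with $r$ coprime to $k$. *)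

theory Defs
  imports "HOL-Analysis.Analysis"
begin

text \<open>The Euclidean plane is the type \<^typ>\<open>complex\<close>.\<close>

definition rotation :: "real \<Rightarrow> complex \<Rightarrow> complex" where
  "rotation \<theta> z = cis \<theta> * z"

text \<open>A simple closed curve of class \<open>C\<^sup>2\<close> and length \<open>l\<close>, given by its \<open>l\<close>-periodic arc length
  parametrization. Either orientation is allowed.\<close>

definition C2_closed_curve :: "(real \<Rightarrow> complex) \<Rightarrow> real \<Rightarrow> bool" where
  "C2_closed_curve \<gamma> l \<longleftrightarrow>
     l > 0 \<and>
     (\<forall>s. \<gamma> (s + l) = \<gamma> s) \<and>
     inj_on \<gamma> {0..<l} \<and>
     \<gamma> C1_differentiable_on UNIV \<and>
     (\<lambda>s. vector_derivative \<gamma> (at s)) C1_differentiable_on UNIV \<and>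
     (\<forall>s. norm (vector_derivative \<gamma> (at s)) = 1)"

text \<open>The closed region bounded by the curve is strictly convex. In particular the curve contains
  no line segment, but its curvature may vanish at some points.\<close>

definition strictly_convex_curve :: "complex set \<Rightarrow> bool" where
  "strictly_convex_curve \<Gamma> \<longleftrightarrow>
     (\<forall>x \<in> \<Gamma> \<union> inside \<Gamma>. \<forall>y \<in> \<Gamma> \<union> inside \<Gamma>. x \<noteq> y \<longrightarrow> open_segment x y \<subseteq> inside \<Gamma>)"

definition angle_between :: "complex \<Rightarrow> complex \<Rightarrow> real" where
  "angle_between u v = arccos (inner u v / (norm u * norm v))"

text \<open>The arc length parameter modulo \<open>l\<close> is identified with the corresponding point of the curve, so
  the pair \<open>(\<gamma> s, \<alpha>)\<close> stands for the point of the cylinder with coordinates \<open>(s, \<alpha>)\<close>, and the cylinder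
  carries the subspace topology.\<close>

definition phase_cylinder :: "(real \<Rightarrow> complex) \<Rightarrow> (complex \<times> real) set" where
  "phase_cylinder \<gamma> = range \<gamma> \<times> {0<..<pi}"

text \<open>The oriented line with coordinates \<open>(\<gamma> s, \<alpha>)\<close> meets the curve again at \<open>\<gamma> s'\<close>. By the law of
  reflection the reflected line, which starts at \<open>\<gamma> s'\<close>, makes with the tangent vector there the same
  angle as the incoming line. For a strictly convex \<open>C\<^sup>2\<close> curve and a point of the cylinder the
  description below determines a unique point of the cylinder: the curve lies on one side of its
  tangent line at \<open>\<gamma> s\<close>, so the unoriented angle at \<open>\<gamma> s\<close> determines the chord. Elsewhere the value
  is irrelevant.\<close>

definition billiard_map :: "(real \<Rightarrow> complex) \<Rightarrow> complex \<times> real \<Rightarrow> complex \<times> real" where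
  "billiard_map \<gamma> x =
     (THE y. \<exists>s s'. \<gamma> s \<noteq> \<gamma> s' \<and>
        x = (\<gamma> s, angle_between (\<gamma> s' - \<gamma> s) (vector_derivative \<gamma> (at s))) \<and>
        y = (\<gamma> s', angle_between (\<gamma> s' - \<gamma> s) (vector_derivative \<gamma> (at s'))))"

definition minimal_period :: "('a \<Rightarrow> 'a) \<Rightarrow> nat \<Rightarrow> 'a \<Rightarrow> bool" where
  "minimal_period f k x \<longleftrightarrow>
     k > 0 \<and> (f ^^ k) x = x \<and> (\<forall>j. 0 < j \<and> j < k \<longrightarrow> (f ^^ j) x \<noteq> x)"

text \<open>A simple closed curve on a cylinder that is not null-homotopic winds around it exactly once
  (in one of the two directions).\<close>

definition rotational_invariant_curve ::
    "(real \<Rightarrow> complex) \<Rightarrow> (complex \<times> real) set \<Rightarrow> bool" where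
  "rotational_invariant_curve \<gamma> C \<longleftrightarrow>
     (\<exists>c. simple_path c \<and> pathfinish c = pathstart c \<and> path_image c = C \<and>
          C \<subseteq> phase_cylinder \<gamma> \<and>
          \<not> (\<exists>a. homotopic_loops (phase_cylinder \<gamma>) c (linepath a a))) \<and>
     billiard_map \<gamma> ` C = C"

definition rotational_invariant_curve_of_periodic_orbits ::
    "(real \<Rightarrow> complex) \<Rightarrow> nat \<Rightarrow> (complex \<times> real) set \<Rightarrow> bool" where
  "rotational_invariant_curve_of_periodic_orbits \<gamma> k C \<longleftrightarrow>
     rotational_invariant_curve \<gamma> C \<and> (\<forall>x \<in> C. minimal_period (billiard_map \<gamma>) k x)"

definition is_circle :: "complex set \<Rightarrow> bool" where
  "is_circle \<Gamma> \<longleftrightarrow> (\<exists>z r. r > 0 \<and> \<Gamma> = sphere z r)"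

end

theory Submission
  imports Defs
begin

text \<open>Lift the invariant curve to the universal cover and follow the orbits of its points. This gives a
  continuous one-parameter family of real sequences \<open>X a\<close>, the successive bounce parameters, with
  \<open>X a (i + k) = X a i + r * l\<close> for a fixed integer \<open>r\<close> and \<open>X (a + 1) i = X a i + W\<close> for a fixed
  \<open>W \<noteq> 0\<close>, because the curve is not null-homotopic. Call a sequence that obeys the reflection law and
  the first of these identities a configuration of type \<open>r/k\<close>.

  The argument compares configurations coordinatewise. By the twist property
  (\<open>chord_cos_strict_antimono\<close>), two distinct configurations of the same type cannot touch without crossing: if \<open>x \<le> y\<close> and \<open>x i = y i\<close> for some
  \<open>i\<close>, the reflection law at that vertex forces the neighbours to agree as well, hence \<open>x = y\<close>
  (\<open>periodic_configurations_touching\<close>). Now let \<open>x\<close> be any configuration of type \<open>r/k\<close> and let \<open>a\<close>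
  increase from minus infinity; say \<open>W > 0\<close>. At first \<open>X a < x\<close> in all coordinates, and at the first
  parameter where this fails the two touch, so there \<open>X a = x\<close> (\<open>first_hitting\<close>). Therefore
  every configuration of type \<open>r/k\<close> belongs to the family, and of two such configurations the one that
  is reached first lies strictly below the other: they are totally ordered
  (\<open>periodic_configurations_ordered\<close>).

  The rotation acts on the parameter by a translation, and its powers realize the translation by
  \<open>r * l / k\<close> (\<open>rotates_length_div\<close>). So for a configuration \<open>x\<close> also \<open>y i = x (i + 1) - r * l / k\<close> is a
  configuration of the same type. The differences \<open>y i - x i\<close> add up to zero over a period, which rules
  out both \<open>x < y\<close> and \<open>y < x\<close>. Hence \<open>x = y\<close>, that is, \<open>x (i + 1) = x i + c\<close> with \<open>c = r * l / k\<close>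
  (\<open>periodic_configuration_equidistant\<close>).

  By the intermediate value theorem every point \<open>\<gamma> s\<close> is a vertex of such an orbit. Its two
  neighbours \<open>\<gamma> (s + c) = w * \<gamma> s\<close> and \<open>\<gamma> (s - c) = cnj w * \<gamma> s\<close> are mirror images in the line through
  \<open>\<gamma> s\<close> and the centre \<open>0\<close>, and by the reflection law they are mirror images in the normal at \<open>\<gamma> s\<close> as
  well. So the tangent is everywhere orthogonal to the radius, and the curve is a circle.\<close>

section \<open>Plane vectors, loops and periodic functions\<close>

text \<open>In the plane the difference \<open>u - w\<close> is orthogonal to \<open>v\<close>, hence a multiple of \<open>a\<close>; it is also orthogonal
  to \<open>u + w\<close> because the norms agree. So either it vanishes or \<open>u + w\<close>, and then both \<open>u\<close> and \<open>w\<close>, are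
  orthogonal to \<open>a\<close>; in the second case the difference is orthogonal to \<open>a\<close> too, so it vanishes as well.\<close>

lemma unit_vectors_eq_if_on_one_side:
  fixes u w v a :: complex
  assumes "norm u = norm w" "inner u v = inner w v" "v \<noteq> 0" "a \<noteq> 0" "inner a v = 0"
    and "inner a u \<ge> 0" "inner a w \<ge> 0"
  shows "u = w"
proof -
  have "\<exists>c. u - w = of_real c * a"
  proof -
    have perp: "\<exists>c. z = of_real c * (\<i> * v)" if "inner z v = 0" for z
    proof -
      have "Re (z / v) = 0"
        using that by (simp add: Re_divide inner_complex_def cmod_power2[symmetric])
      then have "z / v = of_real (Im (z / v)) * \<i>"
        by (simp add: complex_eq_iff)
      then show ?thesis
        using \<open>v \<noteq> 0\<close> by (metis (no_types) nonzero_eq_divide_eq mult.assoc)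
    qed
    obtain c d where "u - w = of_real c * (\<i> * v)" "a = of_real d * (\<i> * v)"
      using perp[of "u - w"] perp[of a] assms(2,5) by (auto simp: inner_diff_left)
    moreover from this have "d \<noteq> 0" using \<open>a \<noteq> 0\<close> by auto
    ultimately show ?thesis
      by (intro exI[of _ "c / d"]) simp
  qed
  then obtain c where c: "u - w = c *\<^sub>R a" by (auto simp: scaleR_conv_of_real)
  have "inner (u - w) (u + w) = 0"
    using assms(1) by (simp add: inner_diff_left inner_add_right inner_commute[of w u] dot_square_norm)
  then have "c * (inner a u + inner a w) = 0"
    unfolding c by (simp add: inner_add_right distrib_left)
  then consider "c = 0" | "inner a u = 0" "inner a w = 0"
    using assms(6,7) by force
  then show ?thesis
  proof cases
    case 2
    then have "inner a (u - w) = 0" by (simp add: inner_diff_right)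
    then have "c = 0" unfolding c using \<open>a \<noteq> 0\<close> by simp
    then show ?thesis using c by simp
  qed (use c in simp)
qed

lemma inner_mult_unit:
  fixes w :: complex
  assumes "norm w = 1"
  shows "inner (w * x) (w * y) = inner x y"
proof -
  have "(Re w)\<^sup>2 + (Im w)\<^sup>2 = 1"
    using assms by (metis cmod_power2 one_power2)
  moreover have "inner (w * x) (w * y) = ((Re w)\<^sup>2 + (Im w)\<^sup>2) * inner x y"
    by (simp add: inner_complex_def algebra_simps power2_eq_square)
  ultimately show ?thesis by simp
qed

lemma cis_root_neq_1:
  assumes "n \<ge> (2::nat)"
  shows "cis (2 * pi / n) \<noteq> 1"
proof -
  have "cos (2 * pi / n) < cos 0"
    using assms by (intro cos_monotone_0_pi) (auto simp: field_simps)
  then show ?thesis by (auto simp: complex_eq_iff)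
qed

lemma continuous_integer_multiple_constant:
  fixes f :: "real \<Rightarrow> real"
  assumes cont: "continuous_on UNIV f" and int: "\<And>a. \<exists>n::int. f a = of_int n * c" and c: "c > 0"
  shows "\<exists>n::int. \<forall>a. f a = of_int n * c"
proof -
  have "f constant_on UNIV"
  proof (rule continuous_discrete_range_constant[OF connected_UNIV cont])
    fix x
    have "c \<le> norm (f y - f x)" if "f y \<noteq> f x" for y
    proof -
      obtain m n :: int where mn: "f x = of_int m * c" "f y = of_int n * c"
        using int by metis
      then have "1 \<le> \<bar>n - m\<bar>" using that by auto
      then have "1 * c \<le> of_int \<bar>n - m\<bar> * c"
        using c by (intro mult_right_mono) (auto simp flip: of_int_abs)
      also have "\<dots> = norm (f y - f x)"
        using c by (simp add: mn abs_mult flip: left_diff_distrib)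
      finally show ?thesis by simp
    qed
    then show "\<exists>e>0. \<forall>y. y \<in> UNIV \<and> f y \<noteq> f x \<longrightarrow> e \<le> norm (f y - f x)"
      using c by blast
  qed
  then show ?thesis
    using int by (metis UNIV_I constant_on_def)
qed

text \<open>A loop factors through the unit circle, on which it is continuous; composing with \<open>t \<mapsto> cis (2 * pi * t)\<close>
  gives continuity at the integers without gluing.\<close>

lemma loop_periodic_extension:
  fixes c :: "real \<Rightarrow> 'a::topological_space"
  assumes "path c" "pathfinish c = pathstart c"
  obtains q where "continuous_on UNIV q" "\<And>t. q (t + 1) = q t" "range q \<subseteq> path_image c"
    "\<And>t. t \<in> {0..1} \<Longrightarrow> q t = c t"
proof
  define q where "q t = c (Arg2pi (cis (2 * pi * t)) / (2 * pi))" for t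
  have "homotopic_loops (path_image c) c c"
    using assms by (simp add: homotopic_loops_refl)
  then have "continuous_on (sphere 0 1) (c \<circ> (\<lambda>z. Arg2pi z / (2 * pi)))"
    using homotopic_loops_imp_homotopic_circlemaps homotopic_with_imp_continuous by blast
  then have "continuous_on UNIV (\<lambda>t. (c \<circ> (\<lambda>z. Arg2pi z / (2 * pi))) (cis (2 * pi * t)))"
    by (rule continuous_on_compose2) (auto intro!: continuous_intros)
  then show "continuous_on UNIV q" by (simp add: q_def[abs_def] o_def)
  show "q (t + 1) = q t" for t
    by (simp add: q_def distrib_left flip: cis_mult)
  show "range q \<subseteq> path_image c"
  proof -
    have "Arg2pi z / (2 * pi) \<in> {0..1}" for z
      using Arg2pi_ge_0[of z] Arg2pi_lt_2pi[of z] by simp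
    then show ?thesis unfolding q_def path_image_def by blast
  qed
  show "q t = c t" if t: "t \<in> {0..1}" for t
  proof (cases "t = 1")
    case True
    have "Arg2pi 1 = 0" by (rule Arg2pi_unique[of 1]) auto
    then show ?thesis
      using assms(2) by (simp add: True q_def pathfinish_def pathstart_def)
  next
    case False
    have "Arg2pi (cis (2 * pi * t)) = 2 * pi * t"
      by (rule Arg2pi_unique[of 1]) (use t False in \<open>auto simp: cis_conv_exp\<close>)
    then show ?thesis by (simp add: q_def)
  qed
qed

lemma loop_translate_int:
  fixes f :: "real \<Rightarrow> real"
  assumes "\<And>a. f (a + 1) = f a + W"
  shows "f (a + of_int n) = f a + of_int n * W"
proof (induction n rule: int_induct[where k = 0])
  case (step1 i)
  then show ?case using assms[of "a + of_int i"] by (simp add: algebra_simps)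
next
  case (step2 i)
  then show ?case using assms[of "a + of_int (i - 1)"] by (simp add: algebra_simps)
qed simp

text \<open>By the translation rule, \<open>f a\<close> exceeds \<open>a * W\<close> by no more than the maximum of \<open>f\<close> over one period.
  This is what makes the first hitting times below finite.\<close>

lemma superlevel_bdd_below:
  fixes f :: "real \<Rightarrow> real"
  assumes f: "\<And>a. f (a + 1) = f a + W" and cont: "continuous_on UNIV f" and W: "W > 0"
  shows "bdd_below {a. c \<le> f a}"
proof -
  have "bounded (f ` {0..1})"
    by (intro compact_imp_bounded compact_continuous_image continuous_on_subset[OF cont]) auto
  then obtain B where B: "\<And>a. a \<in> {0..1} \<Longrightarrow> f a \<le> B"
    unfolding bounded_iff by (metis abs_le_D1 imageI real_norm_def)
  show ?thesis
  proof (rule bdd_belowI)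
    fix a assume a: "a \<in> {a. c \<le> f a}"
    have "f a = f (frac a) + of_int \<lfloor>a\<rfloor> * W"
      using loop_translate_int[of f W "frac a" "\<lfloor>a\<rfloor>"] f by (simp add: frac_def)
    also have "\<dots> \<le> B + a * W"
      by (intro add_mono B mult_right_mono) (use W frac_lt_1[of a] in \<open>auto intro: less_imp_le\<close>)
    finally show "(c - B) / W \<le> a"
      using a W by (simp add: field_simps)
  qed
qed

lemma loop_surj:
  fixes f :: "real \<Rightarrow> real"
  assumes cont: "continuous_on UNIV f" and shift: "\<And>a. f (a + 1) = f a + W" and W: "W \<noteq> 0"
  obtains a where "f a = s"
proof -
  obtain n :: nat where n: "\<bar>s - f 0\<bar> \<le> real n * \<bar>W\<bar>"
    using reals_Archimedean3[of "\<bar>W\<bar>"] W by (metis less_imp_le zero_less_abs_iff)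
  have f: "f (real n) = f 0 + real n * W" "f (- real n) = f 0 - real n * W"
    using loop_translate_int[of f W 0 "int n"] loop_translate_int[of f W 0 "- int n"] shift
    by simp_all
  have "connected (range f)"
    by (intro connected_continuous_image cont connected_UNIV)
  moreover have "f (real n) \<in> range f" "f (- real n) \<in> range f" by auto
  moreover have "f (real n) \<le> s \<and> s \<le> f (- real n) \<or> f (- real n) \<le> s \<and> s \<le> f (real n)"
    unfolding f using n by (cases "W > 0") (auto simp: abs_le_iff abs_if split: if_splits)
  ultimately have "s \<in> range f"
    by (meson connectedD_interval)
  then show ?thesis using that by blast
qed

section \<open>The curve and its supporting lines\<close>

locale billiard_table =
  fixes \<gamma> :: "real \<Rightarrow> complex" and l :: real
  assumes curve: "C2_closed_curve \<gamma> l"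
    and convex: "strictly_convex_curve (range \<gamma>)"
begin

definition tangent :: "real \<Rightarrow> complex" where
  "tangent s = vector_derivative \<gamma> (at s)"

lemma l_pos: "l > 0"
  and periodic: "\<gamma> (s + l) = \<gamma> s"
  and inj: "inj_on \<gamma> {0..<l}"
  and norm_tangent [simp]: "norm (tangent s) = 1"
  using curve by (auto simp: C2_closed_curve_def tangent_def)

lemma has_tangent: "(\<gamma> has_vector_derivative tangent s) (at s)"
proof -
  obtain D where D: "\<And>s. (\<gamma> has_vector_derivative D s) (at s)"
    using curve by (auto simp: C2_closed_curve_def C1_differentiable_on_def)
  then show ?thesis
    unfolding tangent_def by (metis vector_derivative_at)
qed

lemma continuous_on_tangent: "continuous_on UNIV tangent"
proof -
  obtain D where D: "\<And>s. (\<gamma> has_vector_derivative D s) (at s)" "continuous_on UNIV D"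
    using curve by (auto simp: C2_closed_curve_def C1_differentiable_on_def)
  then have "tangent = D"
    by (auto simp: tangent_def vector_derivative_at)
  with D show ?thesis by simp
qed

lemma continuous_on_curve: "continuous_on A \<gamma>"
  by (intro continuous_at_imp_continuous_on ballI has_vector_derivative_continuous[OF has_tangent])

lemma periodic_int: "\<gamma> (s + of_int n * l) = \<gamma> s"
proof (induction n rule: int_induct[where k = 0])
  case (step1 i)
  then show ?case using periodic[of "s + of_int i * l"] by (simp add: algebra_simps)
next
  case (step2 i)
  then show ?case using periodic[of "s + of_int (i - 1) * l"] by (simp add: algebra_simps)
qed simp

lemma parameter_mod_length:
  obtains n :: int where "s + of_int n * l \<in> {0..<l}"
proof
  have "s / l - of_int \<lfloor>s / l\<rfloor> \<ge> 0" "s / l - of_int \<lfloor>s / l\<rfloor> < 1"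
    by linarith+
  then have "(s / l - of_int \<lfloor>s / l\<rfloor>) * l \<ge> 0" "(s / l - of_int \<lfloor>s / l\<rfloor>) * l < 1 * l"
    using l_pos by (simp, intro mult_strict_right_mono)
  moreover have "(s / l - of_int \<lfloor>s / l\<rfloor>) * l = s + of_int (- \<lfloor>s / l\<rfloor>) * l"
    using l_pos by (simp add: field_simps)
  ultimately show "s + of_int (- \<lfloor>s / l\<rfloor>) * l \<in> {0..<l}"
    by simp
qed

lemma curve_eq_iff: "\<gamma> s = \<gamma> t \<longleftrightarrow> (\<exists>n::int. t = s + of_int n * l)"
proof
  assume eq: "\<gamma> s = \<gamma> t"
  obtain m n :: int where mn: "s + of_int m * l \<in> {0..<l}" "t + of_int n * l \<in> {0..<l}"
    using parameter_mod_length by metis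
  have "s + of_int m * l = t + of_int n * l"
    by (rule inj_onD[OF inj]) (use mn eq in \<open>simp_all only: periodic_int\<close>)
  then show "\<exists>n::int. t = s + of_int n * l"
    by (intro exI[of _ "m - n"]) (simp add: algebra_simps)
qed (use periodic_int in auto)

lemma curve_neq: "s < t \<Longrightarrow> t < s + l \<Longrightarrow> \<gamma> s \<noteq> \<gamma> t"
proof
  assume st: "s < t" "t < s + l" and "\<gamma> s = \<gamma> t"
  then obtain n :: int where n: "t = s + of_int n * l"
    by (auto simp: curve_eq_iff)
  then have "0 < of_int n * l" "of_int n * l < 1 * l"
    using st by auto
  then have "0 < n" "n < 1"
    using l_pos by (auto simp: zero_less_mult_iff mult_less_cancel_right)
  then show False by simp
qed

lemma tangent_periodic_int: "tangent (s + of_int n * l) = tangent s"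
proof -
  have "((\<gamma> \<circ> (\<lambda>x. x + of_int n * l)) has_vector_derivative 1 *\<^sub>R tangent (s + of_int n * l)) (at s)"
    by (rule vector_diff_chain_at) (auto intro!: derivative_eq_intros has_tangent)
  moreover have "\<gamma> \<circ> (\<lambda>x. x + of_int n * l) = \<gamma>"
    using periodic_int by auto
  ultimately show ?thesis
    using vector_derivative_unique_at[OF _ has_tangent[of s]] by simp
qed

lemma tangent_cong: "\<gamma> s = \<gamma> t \<Longrightarrow> tangent s = tangent t"
  using tangent_periodic_int by (auto simp: curve_eq_iff)

lemma range_curve: "range \<gamma> = \<gamma> ` {0..l}"
proof -
  have "\<gamma> s \<in> \<gamma> ` {0..l}" for s
  proof -
    obtain n :: int where "s + of_int n * l \<in> {0..<l}"
      by (rule parameter_mod_length)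
    then have "s + of_int n * l \<in> {0..l}" by simp
    then show ?thesis
      by (metis periodic_int imageI)
  qed
  then show ?thesis by auto
qed

lemma Jordan_curve:
  shows "open (inside (range \<gamma>))" "inside (range \<gamma>) \<noteq> {}"
    and "frontier (outside (range \<gamma>)) = range \<gamma>"
proof -
  define c where "c t = \<gamma> (l * t)" for t
  have cont: "path c"
    unfolding path_def c_def
    by (intro continuous_on_compose2[OF continuous_on_curve[of UNIV]] continuous_intros) auto
  have "x = y \<or> x = 0 \<and> y = 1 \<or> x = 1 \<and> y = 0"
    if xy: "x \<in> {0..1}" "y \<in> {0..1}" and "c x = c y" for x y
  proof -
    have "\<gamma> (l * x) = \<gamma> (l * y)"
      using that by (simp add: c_def)
    then obtain n :: int where "l * y = l * x + of_int n * l"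
      by (auto simp: curve_eq_iff)
    then have "l * y = l * (x + of_int n)" by (simp add: algebra_simps)
    then have n: "y = x + of_int n" using l_pos by simp
    with xy have "- 1 \<le> n" "n \<le> 1"
      by simp_all
    then have "n = -1 \<or> n = 0 \<or> n = 1" by linarith
    with n xy show ?thesis by auto
  qed
  then have "simple_path c"
    using cont by (auto simp: simple_path_def loop_free_def)
  moreover have "pathfinish c = pathstart c"
    using periodic[of 0] by (simp add: c_def pathfinish_def pathstart_def)
  moreover have "path_image c = range \<gamma>"
  proof -
    have "path_image c = \<gamma> ` ((*) l ` {0..1})"
      by (auto simp: path_image_def c_def image_image)
    also have "(*) l ` {0..1} = {0..l}"
      using l_pos by (simp add: image_mult_atLeastAtMost)
    finally show ?thesis by (simp add: range_curve)
  qed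
  ultimately show "open (inside (range \<gamma>))" "inside (range \<gamma>) \<noteq> {}"
    and "frontier (outside (range \<gamma>)) = range \<gamma>"
    using Jordan_inside_outside[of c] by simp_all
qed

text \<open>A point of the curve is a limit of points outside it, so it is not interior to the convex region that
  the curve bounds, and a supporting line passes through it. Along the curve the distance to this line
  is minimal at the point, so the line is the tangent line.\<close>

lemma curve_on_one_side:
  obtains a where "a \<noteq> 0" "inner a (tangent s) = 0" "\<And>t. inner a (\<gamma> s) \<le> inner a (\<gamma> t)"
proof -
  define K where "K = range \<gamma> \<union> inside (range \<gamma>)"
  have "z \<in> K" if "x \<in> K" "y \<in> K" "z \<in> open_segment x y" for x y z
  proof -
    have "x \<noteq> y" using that(3) by auto
    then have "open_segment x y \<subseteq> inside (range \<gamma>)"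
      using convex that(1,2) unfolding strictly_convex_curve_def K_def by blast
    then show ?thesis
      using that(3) unfolding K_def by blast
  qed
  then have "convex K"
    unfolding convex_contains_open_segment by blast
  have "inside (range \<gamma>) \<subseteq> interior K"
    using Jordan_curve(1) by (intro interior_maximal) (auto simp: K_def)
  then have "interior K \<noteq> {}"
    using Jordan_curve(2) by blast
  then have rel: "rel_interior K = interior K"
    by (rule rel_interior_nonempty_interior)
  have "\<gamma> s \<notin> interior K"
  proof
    assume "\<gamma> s \<in> interior K"
    moreover have "\<gamma> s \<in> closure (outside (range \<gamma>))"
      using Jordan_curve(3) unfolding frontier_def by blast
    ultimately have "interior K \<inter> outside (range \<gamma>) \<noteq> {}"
      using open_Int_closure_eq_empty[OF open_interior] by blast
    moreover have "K \<inter> outside (range \<gamma>) = {}"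
      unfolding K_def using inside_Int_outside outside_no_overlap by blast
    ultimately show False
      using interior_subset[of K] by blast
  qed
  moreover have "\<gamma> s \<in> K"
    by (simp add: K_def)
  ultimately obtain a where a: "a \<noteq> 0" "\<And>y. y \<in> K \<Longrightarrow> inner a (\<gamma> s) \<le> inner a y"
    using supporting_hyperplane_rel_boundary[OF \<open>convex K\<close>, of "\<gamma> s"] rel by metis
  have le: "inner a (\<gamma> s) \<le> inner a (\<gamma> t)" for t
    by (rule a(2)) (simp add: K_def)
  have "((\<lambda>t. inner a (\<gamma> t)) has_vector_derivative inner a (tangent s)) (at s)"
    using bounded_linear.has_vector_derivative[OF bounded_linear_inner_right has_tangent] .
  then have "((\<lambda>t. inner a (\<gamma> t)) has_real_derivative inner a (tangent s)) (at s)"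
    by (simp add: has_real_derivative_iff_has_vector_derivative)
  then have "inner a (tangent s) = 0"
    by (rule DERIV_local_min[where d = 1]) (use le in auto)
  then show ?thesis
    by (rule that[OF a(1) _ le])
qed

section \<open>The twist property\<close>

text \<open>The cosine of the angle at \<open>\<gamma> s\<close> between the chord to \<open>\<gamma> t\<close> and the tangent. Up to sign it is a partial
  derivative of the generating function \<open>L s t = norm (\<gamma> t - \<gamma> s)\<close>: the derivative in \<open>s\<close> is
  \<open>- chord_cos s t\<close> and the derivative in \<open>t\<close> is \<open>- chord_cos t s\<close>.\<close>

definition chord_cos :: "real \<Rightarrow> real \<Rightarrow> real" where
  "chord_cos s t = inner (\<gamma> t - \<gamma> s) (tangent s) / norm (\<gamma> t - \<gamma> s)"

lemma angle_between_chord_tangent: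
  "angle_between (\<gamma> t - \<gamma> s) (tangent s) = arccos (chord_cos s t)"
  by (simp add: angle_between_def chord_cos_def)

lemma angle_between_chord_end_tangent:
  "angle_between (\<gamma> t - \<gamma> s) (tangent t) = arccos (- chord_cos t s)"
  by (simp add: angle_between_def chord_cos_def norm_minus_commute inner_diff_left diff_divide_distrib)

lemma chord_cos_cong: "\<gamma> s = \<gamma> s' \<Longrightarrow> \<gamma> t = \<gamma> t' \<Longrightarrow> chord_cos s t = chord_cos s' t'"
  unfolding chord_cos_def using tangent_cong[of s s'] by simp

lemma abs_chord_cos_le: "\<bar>chord_cos s t\<bar> \<le> 1"
  using Cauchy_Schwarz_ineq2[of "\<gamma> t - \<gamma> s" "tangent s"]
  by (auto simp: chord_cos_def divide_le_eq_1)

lemma curve_notin_open_segment: "\<gamma> t \<notin> open_segment (\<gamma> s) (\<gamma> r)"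
proof
  assume t: "\<gamma> t \<in> open_segment (\<gamma> s) (\<gamma> r)"
  then have "\<gamma> s \<noteq> \<gamma> r" by auto
  then have "\<gamma> t \<in> inside (range \<gamma>)"
    using convex t unfolding strictly_convex_curve_def by blast
  then show False
    using inside_no_overlap by blast
qed

text \<open>Two chords from \<open>\<gamma> s\<close> with the same cosine have either the same direction or directions that are mirror
  images in the tangent line. The curve lies on one side of that line, so the directions agree; and if
  the endpoints differed, the nearer one would be a curve point inside the segment to the other.\<close>

lemma chord_cos_inj:
  assumes "\<gamma> t \<noteq> \<gamma> s" "\<gamma> r \<noteq> \<gamma> s" "chord_cos s t = chord_cos s r"
  shows "\<gamma> t = \<gamma> r"
  using assms
proof (induction "norm (\<gamma> t - \<gamma> s)" "norm (\<gamma> r - \<gamma> s)" arbitrary: t r rule: linorder_wlog)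
  case le
  define m n where "m = norm (\<gamma> t - \<gamma> s)" and "n = norm (\<gamma> r - \<gamma> s)"
  have pos: "m > 0" "n > 0" using le by (simp_all add: m_def n_def)
  obtain a where a: "a \<noteq> 0" "inner a (tangent s) = 0" "\<And>t. inner a (\<gamma> s) \<le> inner a (\<gamma> t)"
    using curve_on_one_side[of s] by metis
  have "(\<gamma> t - \<gamma> s) /\<^sub>R m = (\<gamma> r - \<gamma> s) /\<^sub>R n"
  proof (rule unit_vectors_eq_if_on_one_side[where v = "tangent s" and a = a])
    show "inner ((\<gamma> t - \<gamma> s) /\<^sub>R m) (tangent s) = inner ((\<gamma> r - \<gamma> s) /\<^sub>R n) (tangent s)"
      using le(4) by (simp add: chord_cos_def m_def n_def divide_inverse mult.commute)
    show "tangent s \<noteq> 0"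
      using norm_tangent[of s] by force
    show "norm ((\<gamma> t - \<gamma> s) /\<^sub>R m) = norm ((\<gamma> r - \<gamma> s) /\<^sub>R n)"
      using pos by (simp add: m_def n_def)
  qed (use a pos in \<open>auto simp: inner_diff_right\<close>)
  then have eq: "\<gamma> t - \<gamma> s = (m / n) *\<^sub>R (\<gamma> r - \<gamma> s)"
    using pos by (metis divide_inverse scaleR_scaleR scaleR_one right_inverse less_irrefl)
  show ?case
  proof (cases "m = n")
    case True
    then show ?thesis using eq pos by simp
  next
    case False
    have "\<gamma> t = (1 - m / n) *\<^sub>R \<gamma> s + (m / n) *\<^sub>R \<gamma> r"
      using eq by (simp add: algebra_simps)
    moreover have "0 < m / n" "m / n < 1"
      using pos False le(1) by (auto simp: m_def n_def)
    ultimately have "\<gamma> t \<in> open_segment (\<gamma> s) (\<gamma> r)"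
      using le by (auto simp: in_segment)
    then show ?thesis using curve_notin_open_segment by blast
  qed
qed metis

lemma tendsto_chord_cos [tendsto_intros]:
  assumes "(f \<longlongrightarrow> s) F" "(g \<longlongrightarrow> t) F" "\<gamma> t \<noteq> \<gamma> s"
  shows "((\<lambda>x. chord_cos (f x) (g x)) \<longlongrightarrow> chord_cos s t) F"
proof -
  have "isCont \<gamma> x" "isCont tangent x" for x
    using continuous_on_curve[of UNIV] continuous_on_tangent by (auto simp: continuous_on_eq_continuous_at)
  then have "((\<lambda>x. \<gamma> (f x)) \<longlongrightarrow> \<gamma> s) F" "((\<lambda>x. \<gamma> (g x)) \<longlongrightarrow> \<gamma> t) F"
    "((\<lambda>x. tangent (f x)) \<longlongrightarrow> tangent s) F"
    using assms isCont_tendsto_compose by blast+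
  then show ?thesis
    unfolding chord_cos_def using assms(3) by (intro tendsto_intros) auto
qed

lemma tendsto_difference_quotient:
  "((\<lambda>t. (\<gamma> t - \<gamma> s) /\<^sub>R (t - s)) \<longlongrightarrow> tangent s) (at s)"
proof -
  have "((\<lambda>t. (1 / norm (t - s)) *\<^sub>R (\<gamma> t - (\<gamma> s + (t - s) *\<^sub>R tangent s))) \<longlongrightarrow> 0) (at s)"
    using has_tangent[of s] unfolding has_vector_derivative_def has_derivative_within by blast
  then have "((\<lambda>t. norm ((1 / norm (t - s)) *\<^sub>R (\<gamma> t - (\<gamma> s + (t - s) *\<^sub>R tangent s)))) \<longlongrightarrow> 0) (at s)"
    by (rule tendsto_norm_zero)
  moreover have "\<forall>\<^sub>F t in at s. norm ((1 / norm (t - s)) *\<^sub>R (\<gamma> t - (\<gamma> s + (t - s) *\<^sub>R tangent s))) =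
      norm ((\<gamma> t - \<gamma> s) /\<^sub>R (t - s) - tangent s)"
  proof -
    have "norm ((1 / norm (t - s)) *\<^sub>R (\<gamma> t - (\<gamma> s + (t - s) *\<^sub>R tangent s))) =
      norm ((\<gamma> t - \<gamma> s) /\<^sub>R (t - s) - tangent s)" if "t \<noteq> s" for t
    proof -
      have "(\<gamma> t - \<gamma> s) /\<^sub>R (t - s) - tangent s =
          inverse (t - s) *\<^sub>R (\<gamma> t - (\<gamma> s + (t - s) *\<^sub>R tangent s))"
        using that by (simp add: scaleR_diff_right diff_diff_add[symmetric])
      then show ?thesis by (simp add: divide_inverse)
    qed
    then show ?thesis by (auto simp: eventually_at_filter)
  qed
  ultimately have "((\<lambda>t. norm ((\<gamma> t - \<gamma> s) /\<^sub>R (t - s) - tangent s)) \<longlongrightarrow> 0) (at s)"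
    by (rule Lim_transform_eventually)
  then show ?thesis
    using LIM_zero_cancel tendsto_norm_zero_iff by blast
qed

text \<open>The chord becomes tangent as its endpoint approaches \<open>\<gamma> s\<close>, from either end of the curve.\<close>

lemma chord_cos_limits:
  shows "(chord_cos s \<longlongrightarrow> 1) (at_right s)" and "(chord_cos s \<longlongrightarrow> - 1) (at_left (s + l))"
proof -
  define Q where "Q t = (\<gamma> t - \<gamma> s) /\<^sub>R (t - s)" for t
  have "tangent s \<noteq> 0" using norm_tangent[of s] by force
  have "inner (tangent s) (tangent s) / norm (tangent s) = 1"
    by (simp add: dot_square_norm)
  moreover have "((\<lambda>t. inner (Q t) (tangent s) / norm (Q t)) \<longlongrightarrow>
      inner (tangent s) (tangent s) / norm (tangent s)) (at s)"
    unfolding Q_def using \<open>tangent s \<noteq> 0\<close>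
    by (intro tendsto_intros tendsto_difference_quotient) auto
  ultimately have Q: "((\<lambda>t. inner (Q t) (tangent s) / norm (Q t)) \<longlongrightarrow> 1) (at s)"
    by simp
  have "\<forall>\<^sub>F t in at_right s. inner (Q t) (tangent s) / norm (Q t) = chord_cos s t"
    by (rule eventually_mono[OF eventually_at_right_less]) (auto simp: Q_def chord_cos_def abs_if)
  then show "(chord_cos s \<longlongrightarrow> 1) (at_right s)"
    by (rule Lim_transform_eventually[rotated]) (use Q filterlim_at_split in blast)
  have "\<forall>\<^sub>F t in at_left s. t < s"
    by (simp add: eventually_at_filter)
  then have "\<forall>\<^sub>F t in at_left s. - (inner (Q t) (tangent s) / norm (Q t)) = chord_cos s (t + l)"
    by eventually_elim (auto simp: Q_def chord_cos_def periodic abs_if)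
  moreover have "((\<lambda>t. - (inner (Q t) (tangent s) / norm (Q t))) \<longlongrightarrow> - 1) (at_left s)"
    by (intro tendsto_minus) (use Q filterlim_at_split in blast)
  ultimately have "((\<lambda>t. chord_cos s (t + l)) \<longlongrightarrow> - 1) (at_left s)"
    using Lim_transform_eventually by force
  moreover have "at_left s = filtermap (\<lambda>x. x - l) (at_left (s + l))"
    by (simp add: filtermap_at_left_shift)
  ultimately show "(chord_cos s \<longlongrightarrow> - 1) (at_left (s + l))"
    by (simp add: filterlim_filtermap)
qed

lemma continuous_on_chord_cos: "continuous_on {s<..<s + l} (chord_cos s)"
  unfolding continuous_on_def
proof
  fix t assume "t \<in> {s<..<s + l}"
  then have "\<gamma> t \<noteq> \<gamma> s" using curve_neq[of s t] by auto
  then show "(chord_cos s \<longlongrightarrow> chord_cos s t) (at t within {s<..<s + l})"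
    by (intro tendsto_intros)
qed

text \<open>The twist property. The cosine is continuous and injective on the interval, hence strictly monotone;
  it decreases because it starts from its largest possible value \<open>1\<close>.\<close>

lemma chord_cos_strict_antimono:
  assumes "s < t" "t < r" "r < s + l"
  shows "chord_cos s r < chord_cos s t"
proof (rule ccontr)
  have neq: "\<gamma> x \<noteq> \<gamma> s" if "s < x" "x < s + l" for x
    using curve_neq[of s x] that by auto
  have inj': "x = y" if "s < x" "x < s + l" "s < y" "y < s + l" "chord_cos s x = chord_cos s y" for x y
  proof -
    have "\<gamma> x = \<gamma> y" using chord_cos_inj[of x s y] neq that by blast
    then show ?thesis
      using curve_neq[of x y] curve_neq[of y x] that by (cases x y rule: linorder_cases) auto
  qed
  assume "\<not> chord_cos s r < chord_cos s t"
  moreover have "chord_cos s r \<noteq> chord_cos s t" using inj'[of r t] assms by auto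
  ultimately have "chord_cos s t < chord_cos s r" by simp
  \<comment> \<open>If the cosine increased from \<open>t\<close> to \<open>r\<close>, the value \<open>m\<close> would be taken once between \<open>s\<close> and \<open>t\<close> and
    once between \<open>t\<close> and \<open>r\<close>.\<close>
  then obtain m where m: "chord_cos s t < m" "m < chord_cos s r" using dense by blast
  then have "m < 1" using abs_chord_cos_le[of s r] by linarith
  then have "\<forall>\<^sub>F x in at_right s. m < chord_cos s x"
    using chord_cos_limits(1) order_tendstoD by blast
  moreover have "\<forall>\<^sub>F x in at_right s. x < t" "\<forall>\<^sub>F x in at_right s. s < x"
    using assms by (auto simp: eventually_at_right_less intro: eventually_at_right_real order_tendstoD)
  ultimately have "\<forall>\<^sub>F x in at_right s. m < chord_cos s x \<and> x < t \<and> s < x"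
    by eventually_elim simp
  then obtain q where q: "m < chord_cos s q" "q < t" "s < q"
    using eventually_happens'[OF trivial_limit_at_right_real] by blast
  have cont: "continuous_on {x..y} (chord_cos s)" if "s < x" "y < s + l" for x y
    by (rule continuous_on_subset[OF continuous_on_chord_cos]) (use that in auto)
  obtain x where x: "q \<le> x" "x \<le> t" "chord_cos s x = m"
    using IVT2'[of "chord_cos s" t m q] q m cont[of q t] assms by auto
  obtain y where y: "t \<le> y" "y \<le> r" "chord_cos s y = m"
    using IVT'[of "chord_cos s" t m r] m cont[of t r] assms by auto
  have "x = y" using inj'[of x y] x y q assms by simp
  then show False using x y m by force
qed

lemma abs_chord_cos_less:
  assumes "s < t" "t < s + l"
  shows "\<bar>chord_cos s t\<bar> < 1"
proof -
  obtain q r where "s < q" "q < t" "t < r" "r < s + l" using assms dense by metis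
  then show ?thesis
    using chord_cos_strict_antimono[of s q t] chord_cos_strict_antimono[of s t r]
      abs_chord_cos_le[of s q] abs_chord_cos_le[of s r] by linarith
qed

lemma chord_cos_surj:
  assumes "\<bar>u\<bar> < 1"
  obtains t where "s < t" "t < s + l" "chord_cos s t = u"
proof -
  have "\<forall>\<^sub>F x in at_right s. u < chord_cos s x \<and> s < x \<and> x < s + l"
    using assms l_pos
    by (intro eventually_conj order_tendstoD(1)[OF chord_cos_limits(1)] eventually_at_right_less
        order_tendstoD(2)[OF tendsto_ident_at]) auto
  then obtain q where q: "u < chord_cos s q" "s < q" "q < s + l"
    using eventually_happens'[OF trivial_limit_at_right_real] by blast
  have "\<forall>\<^sub>F x in at_left (s + l). chord_cos s x < u \<and> q < x \<and> x < s + l"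
    using assms q
    by (intro eventually_conj order_tendstoD(2)[OF chord_cos_limits(2)]
        order_tendstoD(1)[OF tendsto_ident_at]) (auto simp: eventually_at_filter)
  then obtain r where r: "chord_cos s r < u" "q < r" "r < s + l"
    using eventually_happens'[OF trivial_limit_at_left_real] by blast
  have "continuous_on {q..r} (chord_cos s)"
    by (rule continuous_on_subset[OF continuous_on_chord_cos]) (use q r in auto)
  then obtain t where "q \<le> t" "t \<le> r" "chord_cos s t = u"
    using IVT2'[of "chord_cos s" r u q] q r by auto
  with q r show ?thesis by (intro that[of t]) auto
qed

section \<open>The billiard map on the universal cover\<close>

text \<open>The parameter at which the line that starts at \<open>\<gamma> s\<close> under the angle with cosine \<open>u\<close> meets the curve
  again, chosen in the period after \<open>s\<close>.\<close>

definition exit_param :: "real \<Rightarrow> real \<Rightarrow> real" where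
  "exit_param s u = (THE t. s < t \<and> t < s + l \<and> chord_cos s t = u)"

lemma exit_param_unique:
  assumes "s < t" "t < s + l" "chord_cos s t = u"
  shows "exit_param s u = t"
  unfolding exit_param_def
proof (rule the_equality)
  fix r assume r: "s < r \<and> r < s + l \<and> chord_cos s r = u"
  then show "r = t"
    using assms chord_cos_strict_antimono[of s r t] chord_cos_strict_antimono[of s t r]
    by (cases r t rule: linorder_cases) auto
qed (use assms in simp)

lemma exit_param:
  assumes "\<bar>u\<bar> < 1"
  shows "s < exit_param s u" "exit_param s u < s + l" "chord_cos s (exit_param s u) = u"
proof -
  obtain t where "s < t" "t < s + l" "chord_cos s t = u"
    using chord_cos_surj assms by metis
  then show "s < exit_param s u" "exit_param s u < s + l" "chord_cos s (exit_param s u) = u"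
    using exit_param_unique by simp_all
qed

text \<open>The solution of a strictly monotone equation depends continuously on the data: if \<open>b\<close> is slightly less
  than the solution, the cosine at \<open>b\<close> is larger than \<open>u\<close>, and this persists under small changes of \<open>s\<close>
  and \<open>u\<close>; likewise for \<open>b\<close> slightly greater.\<close>

lemma tendsto_exit_param [tendsto_intros]:
  assumes f: "(f \<longlongrightarrow> s) F" and g: "(g \<longlongrightarrow> u) F" and u: "\<bar>u\<bar> < 1"
  shows "((\<lambda>x. exit_param (f x) (g x)) \<longlongrightarrow> exit_param s u) F"
proof -
  note e = exit_param[OF u, of s]
  have "\<forall>\<^sub>F x in F. \<bar>g x\<bar> < 1"
    using order_tendstoD(2)[OF tendsto_rabs[OF g] u] .
  note ev = this
  show ?thesis
  proof (rule order_tendstoI)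
    fix a assume "a < exit_param s u"
    then have "max a s < exit_param s u" using e by simp
    then obtain b where b: "max a s < b" "b < exit_param s u" using dense by blast
    have "u < chord_cos s b"
      using chord_cos_strict_antimono[of s b "exit_param s u"] e b by simp
    moreover have "((\<lambda>x. chord_cos (f x) b - g x) \<longlongrightarrow> chord_cos s b - u) F"
      using curve_neq[of s b] b e by (intro tendsto_intros f g) auto
    ultimately have "\<forall>\<^sub>F x in F. 0 < chord_cos (f x) b - g x"
      by (intro order_tendstoD(1)) auto
    moreover have "\<forall>\<^sub>F x in F. b - l < f x"
      using order_tendstoD(1)[OF f, of "b - l"] b e by simp
    moreover have "\<forall>\<^sub>F x in F. f x < b" using order_tendstoD(2)[OF f] b by simp
    ultimately show "\<forall>\<^sub>F x in F. a < exit_param (f x) (g x)"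
      using ev
    proof eventually_elim
      case (elim x)
      note ex = exit_param[OF elim(4), of "f x"]
      have "\<not> exit_param (f x) (g x) \<le> b"
        using chord_cos_strict_antimono[of "f x" "exit_param (f x) (g x)" b] ex elim
        by (auto simp: le_less)
      then show ?case using b by simp
    qed
  next
    fix a assume "exit_param s u < a"
    then have "exit_param s u < min a (s + l)" using e by simp
    then obtain b where b: "exit_param s u < b" "b < min a (s + l)" using dense by blast
    have "chord_cos s b < u"
      using chord_cos_strict_antimono[of s "exit_param s u" b] e b by simp
    moreover have "((\<lambda>x. chord_cos (f x) b - g x) \<longlongrightarrow> chord_cos s b - u) F"
      using curve_neq[of s b] b e by (intro tendsto_intros f g) auto
    ultimately have "\<forall>\<^sub>F x in F. chord_cos (f x) b - g x < 0"
      by (intro order_tendstoD(2)) auto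
    moreover have "\<forall>\<^sub>F x in F. b - l < f x" using order_tendstoD(1)[OF f, of "b - l"] b by simp
    moreover have "\<forall>\<^sub>F x in F. f x < b" using order_tendstoD(2)[OF f] b e by simp
    ultimately show "\<forall>\<^sub>F x in F. exit_param (f x) (g x) < a"
      using ev
    proof eventually_elim
      case (elim x)
      note ex = exit_param[OF elim(4), of "f x"]
      have "\<not> b \<le> exit_param (f x) (g x)"
        using chord_cos_strict_antimono[of "f x" b "exit_param (f x) (g x)"] ex elim
        by (auto simp: le_less)
      then show ?case using b by simp
    qed
  qed
qed

text \<open>The billiard map in the coordinates \<open>(s, u)\<close>, where \<open>s\<close> is not reduced modulo the length and \<open>u\<close> is the
  cosine of the angle. The sign comes from \<open>chord_cos\<close>, which measures the chord at its second end in the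
  direction opposite to the motion.\<close>

definition lifted_map :: "real \<times> real \<Rightarrow> real \<times> real" where
  "lifted_map p = (exit_param (fst p) (snd p), - chord_cos (exit_param (fst p) (snd p)) (fst p))"

definition phase_point :: "real \<times> real \<Rightarrow> complex \<times> real" where
  "phase_point p = (\<gamma> (fst p), arccos (snd p))"

lemma abs_snd_lifted_map:
  assumes "\<bar>snd p\<bar> < 1"
  shows "\<bar>snd (lifted_map p)\<bar> < 1"
proof -
  define t where "t = exit_param (fst p) (snd p)"
  have "\<bar>chord_cos t (fst p + l)\<bar> < 1"
    by (rule abs_chord_cos_less) (use exit_param[OF assms, of "fst p"] in \<open>auto simp: t_def\<close>)
  moreover have "chord_cos t (fst p + l) = chord_cos t (fst p)"
    by (rule chord_cos_cong) (auto simp: periodic)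
  ultimately show ?thesis by (simp add: lifted_map_def t_def)
qed

lemma abs_snd_lifted_map_funpow: "\<bar>snd p\<bar> < 1 \<Longrightarrow> \<bar>snd ((lifted_map ^^ i) p)\<bar> < 1"
  by (induction i) (auto intro: abs_snd_lifted_map)

text \<open>The definite description in \<open>billiard_map\<close> has a unique value: the angle determines its cosine, the cosine
  determines the endpoint by \<open>chord_cos_inj\<close>, and the tangent depends only on the point of the curve.\<close>

lemma billiard_map_phase_point:
  assumes "\<bar>snd p\<bar> < 1"
  shows "billiard_map \<gamma> (phase_point p) = phase_point (lifted_map p)"
proof -
  obtain s u where p: "p = (s, u)" by force
  define t where "t = exit_param s u"
  have t: "s < t" "t < s + l" "chord_cos s t = u"
    using exit_param[of u s] assms by (auto simp: t_def p)
  have neq: "\<gamma> s \<noteq> \<gamma> t" using curve_neq t by blast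
  show ?thesis
    unfolding billiard_map_def phase_point_def lifted_map_def p fst_conv snd_conv t_def[symmetric]
      tangent_def[symmetric] angle_between_chord_tangent angle_between_chord_end_tangent
  proof (rule the_equality)
    show "\<exists>s' t'. \<gamma> s' \<noteq> \<gamma> t' \<and> (\<gamma> s, arccos u) = (\<gamma> s', arccos (chord_cos s' t')) \<and>
        (\<gamma> t, arccos (- chord_cos t s)) = (\<gamma> t', arccos (- chord_cos t' s'))"
      using neq t by blast
  next
    fix y assume "\<exists>s' t'. \<gamma> s' \<noteq> \<gamma> t' \<and> (\<gamma> s, arccos u) = (\<gamma> s', arccos (chord_cos s' t')) \<and>
        y = (\<gamma> t', arccos (- chord_cos t' s'))"
    then obtain s' t' where *: "\<gamma> s' \<noteq> \<gamma> t'" "\<gamma> s = \<gamma> s'" "arccos u = arccos (chord_cos s' t')"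
        "y = (\<gamma> t', arccos (- chord_cos t' s'))"
      by blast
    have "u = chord_cos s' t'"
      using *(3) assms abs_chord_cos_le[of s' t'] by (simp add: p arccos_eq_iff)
    also have "\<dots> = chord_cos s t'"
      by (rule chord_cos_cong) (use * in simp_all)
    finally have "\<gamma> t' = \<gamma> t"
      using chord_cos_inj[of t' s t] * neq t by metis
    moreover have "chord_cos t' s' = chord_cos t s"
      by (rule chord_cos_cong) (use * calculation in simp_all)
    ultimately show "y = (\<gamma> t, arccos (- chord_cos t s))"
      using * by simp
  qed
qed

lemma billiard_map_funpow_phase_point:
  assumes "\<bar>snd p\<bar> < 1"
  shows "(billiard_map \<gamma> ^^ i) (phase_point p) = phase_point ((lifted_map ^^ i) p)"
  by (induction i) (simp_all add: billiard_map_phase_point abs_snd_lifted_map_funpow assms)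

lemma lifted_map_translate:
  assumes "\<bar>snd p\<bar> < 1"
  shows "lifted_map (p + (of_int n * l, 0)) = lifted_map p + (of_int n * l, 0)"
proof -
  obtain s u where p: "p = (s, u)" by force
  have cc: "chord_cos (x + of_int n * l) (y + of_int n * l) = chord_cos x y" for x y
    by (rule chord_cos_cong) (simp_all add: periodic_int)
  have "exit_param (s + of_int n * l) u = exit_param s u + of_int n * l"
    by (rule exit_param_unique) (use exit_param[of u s] assms in \<open>simp_all add: p cc\<close>)
  then show ?thesis by (simp add: lifted_map_def p cc)
qed

lemma lifted_map_funpow_translate:
  assumes "\<bar>snd p\<bar> < 1"
  shows "(lifted_map ^^ i) (p + (of_int n * l, 0)) = (lifted_map ^^ i) p + (of_int n * l, 0)"
  by (induction i) (simp_all add: lifted_map_translate abs_snd_lifted_map_funpow assms)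

text \<open>The integer \<open>n\<close> counts the turns around the curve, so \<open>n / k\<close> is the rotation number of the orbit.\<close>

lemma lifted_map_period:
  assumes "\<bar>snd p\<bar> < 1" "(billiard_map \<gamma> ^^ k) (phase_point p) = phase_point p"
  obtains n :: int where "(lifted_map ^^ k) p = p + (of_int n * l, 0)"
proof -
  have eq: "phase_point p = phase_point ((lifted_map ^^ k) p)"
    using assms billiard_map_funpow_phase_point by metis
  then obtain n :: int where n: "fst ((lifted_map ^^ k) p) = fst p + of_int n * l"
    unfolding phase_point_def by (auto simp: curve_eq_iff)
  have "snd ((lifted_map ^^ k) p) = snd p"
    using eq assms abs_snd_lifted_map_funpow[of p k] by (auto simp: phase_point_def arccos_eq_iff)
  with n show ?thesis
    by (intro that[of n]) (simp add: prod_eq_iff)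
qed

lemma tendsto_lifted_map:
  assumes "(f \<longlongrightarrow> p) F" "\<bar>snd p\<bar> < 1"
  shows "((\<lambda>x. lifted_map (f x)) \<longlongrightarrow> lifted_map p) F"
  unfolding lifted_map_def
  using curve_neq[of "fst p" "exit_param (fst p) (snd p)"] exit_param[OF assms(2), of "fst p"]
  by (intro tendsto_intros assms) auto

lemma continuous_on_lifted_map_funpow:
  assumes "continuous_on UNIV P" "\<And>a. \<bar>snd (P a)\<bar> < 1"
  shows "continuous_on UNIV (\<lambda>a. (lifted_map ^^ i) (P a))"
proof (induction i)
  case (Suc i)
  then show ?case
    by (auto simp: continuous_on_def
        intro!: tendsto_lifted_map abs_snd_lifted_map_funpow assms(2))
qed (simp add: assms)

section \<open>Ordering of periodic configurations\<close>

text \<open>The conditions on consecutive bounce parameters of a billiard orbit: each bounce lies within one period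
  after the previous one, and the sum of two consecutive chord lengths is stationary in the middle
  parameter, which is the reflection law.\<close>

definition stationary :: "(nat \<Rightarrow> real) \<Rightarrow> bool" where
  "stationary x \<longleftrightarrow> (\<forall>i. x i < x (Suc i) \<and> x (Suc i) < x i + l \<and>
     chord_cos (x (Suc i)) (x (Suc (Suc i))) = - chord_cos (x (Suc i)) (x i))"

definition periodic_configuration :: "nat \<Rightarrow> real \<Rightarrow> (nat \<Rightarrow> real) \<Rightarrow> bool" where
  "periodic_configuration k R x \<longleftrightarrow> stationary x \<and> (\<forall>i. x (i + k) = x i + R)"

lemma stationary_lifted_orbit:
  assumes "\<bar>snd p\<bar> < 1"
  shows "stationary (\<lambda>i. fst ((lifted_map ^^ i) p))"
  unfolding stationary_def
proof
  fix i
  define q where "q = (lifted_map ^^ i) p"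
  have q: "\<bar>snd q\<bar> < 1" "\<bar>snd (lifted_map q)\<bar> < 1"
    using abs_snd_lifted_map_funpow[OF assms] abs_snd_lifted_map by (auto simp: q_def)
  have "fst (lifted_map q) = exit_param (fst q) (snd q)"
    and "chord_cos (fst (lifted_map q)) (fst (lifted_map (lifted_map q))) = snd (lifted_map q)"
    and "snd (lifted_map q) = - chord_cos (fst (lifted_map q)) (fst q)"
    using exit_param[OF q(2)] by (simp_all add: lifted_map_def)
  then show "fst ((lifted_map ^^ i) p) < fst ((lifted_map ^^ Suc i) p) \<and>
      fst ((lifted_map ^^ Suc i) p) < fst ((lifted_map ^^ i) p) + l \<and>
      chord_cos (fst ((lifted_map ^^ Suc i) p)) (fst ((lifted_map ^^ Suc (Suc i)) p)) =
      - chord_cos (fst ((lifted_map ^^ Suc i) p)) (fst ((lifted_map ^^ i) p))"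
    using exit_param[OF q(1)] by (simp add: q_def)
qed

text \<open>At a common value \<open>m\<close> the reflection law says that \<open>chord_cos m\<close> at the next parameter is the negative of
  \<open>chord_cos m\<close> at the previous one. By the twist property a larger next parameter goes with a smaller
  previous one, so two stationary sequences that meet at a vertex and are not equal around it cross there.\<close>

lemma stationary_neighbours_eq:
  assumes x: "stationary x" and y: "stationary y" and le: "\<And>i. x i \<le> y i"
    and eq: "x (Suc i) = y (Suc i)"
  shows "x i = y i" "x (Suc (Suc i)) = y (Suc (Suc i))"
proof -
  define m where "m = x (Suc i)"
  \<comment> \<open>Adding one period moves the previous parameter into the interval after \<open>m\<close>, where the monotonicity
    is available.\<close>
  have cc: "chord_cos m (t + l) = chord_cos m t" for t
    by (rule chord_cos_cong) (simp_all add: periodic)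
  have X: "m < x (Suc (Suc i))" "x (Suc (Suc i)) < m + l" "x i < m" "m < x i + l"
    "chord_cos m (x (Suc (Suc i))) = - chord_cos m (x i + l)"
    using x by (auto simp: stationary_def m_def cc[unfolded m_def])
  have Y: "m < y (Suc (Suc i))" "y (Suc (Suc i)) < m + l" "y i < m" "m < y i + l"
    "chord_cos m (y (Suc (Suc i))) = - chord_cos m (y i + l)"
    using y by (auto simp: stationary_def m_def eq cc[unfolded m_def eq])
  have *: "\<not> (x (Suc (Suc i)) < y (Suc (Suc i)) \<and> x i \<le> y i)"
    "\<not> (x (Suc (Suc i)) \<le> y (Suc (Suc i)) \<and> x i < y i)"
    using chord_cos_strict_antimono[of m "x (Suc (Suc i))" "y (Suc (Suc i))"]
      chord_cos_strict_antimono[of m "x i + l" "y i + l"] X Y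
    by (auto simp: le_less)
  then show "x i = y i" "x (Suc (Suc i)) = y (Suc (Suc i))"
    using le[of i] le[of "Suc (Suc i)"] by (auto simp: le_less)
qed

text \<open>From one common vertex, equality spreads to both neighbours and so to all vertices.\<close>

lemma periodic_configurations_touching:
  assumes k: "k > 0" and x: "periodic_configuration k R x" and y: "periodic_configuration k R y"
    and le: "\<And>i. x i \<le> y i" and touch: "x j = y j"
  shows "x = y"
proof -
  have nb: "x i = y i" "x (Suc (Suc i)) = y (Suc (Suc i))" if "x (Suc i) = y (Suc i)" for i
    using stationary_neighbours_eq[of x y i] le that x y
    by (simp_all add: periodic_configuration_def)
  \<comment> \<open>A vertex needs a predecessor for the reflection law; one period later it has one even if \<open>j = 0\<close>.\<close>
  obtain m where m: "j + k = Suc m" using k by (cases "j + k") auto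
  have "x (Suc m) = y (Suc m)"
    using x y touch by (simp add: periodic_configuration_def flip: m)
  then have up: "x (Suc m + i) = y (Suc m + i)" for i
  proof (induction i)
    case (Suc i)
    then show ?case using nb(2)[of "m + i"] by simp
  qed simp
  have down: "x i = y i" if "x n = y n" "i \<le> n" for i n
    using that(2,1)
  proof (induction rule: inc_induct)
    case (step i)
    show ?case by (rule nb(1)[OF step.IH[OF step.prems]])
  qed
  show ?thesis
  proof
    fix i show "x i = y i"
      using down[OF up[of i]] by simp
  qed
qed

lemma periodic_configuration_mod:
  assumes "periodic_configuration k R x"
  shows "x i = x (i mod k) + real (i div k) * R"
proof -
  have "x (j + n * k) = x j + real n * R" for j n
  proof (induction n)
    case (Suc n)
    have "x (j + Suc n * k) = x ((j + n * k) + k)" by (simp add: algebra_simps)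
    also have "\<dots> = x (j + n * k) + R"
      using assms by (simp add: periodic_configuration_def)
    finally show ?case using Suc by (simp add: algebra_simps)
  qed simp
  from this[of "i mod k" "i div k"] show ?thesis by simp
qed

text \<open>Strict order involves only finitely many coordinates, so it is an open condition.\<close>

lemma periodic_configurations_less_iff:
  assumes "k > 0" "periodic_configuration k R x" "periodic_configuration k R y"
  shows "(\<forall>i. x i < y i) \<longleftrightarrow> (\<forall>i<k. x i < y i)"
proof safe
  fix i assume "\<forall>i<k. x i < y i"
  then have "x (i mod k) < y (i mod k)" using assms by simp
  then show "x i < y i"
    using periodic_configuration_mod[OF assms(2)] periodic_configuration_mod[OF assms(3)]
    by (metis add_less_cancel_right)
qed auto

text \<open>The set \<open>S\<close> of parameters at which the family is not strictly below \<open>z\<close> is closed, nonempty and bounded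
  below. At its minimum the family is still weakly below \<open>z\<close> and touches it, so it equals \<open>z\<close>.\<close>

lemma first_hitting:
  fixes X :: "real \<Rightarrow> nat \<Rightarrow> real"
  assumes k: "k > 0" and X: "\<And>a. periodic_configuration k R (X a)"
    and cont: "\<And>i. continuous_on UNIV (\<lambda>a. X a i)"
    and shift: "\<And>a i. X (a + 1) i = X a i + W" and W: "W > 0"
    and z: "periodic_configuration k R z"
  obtains b where "X b = z" "\<And>a i. a < b \<Longrightarrow> X a i < z i"
proof -
  define S where "S = (\<Union>i<k. {a. z i \<le> X a i})"
  have less: "X a i < z i" if "a \<notin> S" for a i
  proof -
    have "\<forall>i<k. X a i < z i" using that by (auto simp: S_def not_le)
    then show ?thesis using periodic_configurations_less_iff[OF k X z] by blast
  qed
  have "closed {a. z i \<le> X a i}" for i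
    by (rule closed_Collect_le) (auto intro: cont)
  then have "closed S"
    unfolding S_def by (intro closed_UN) auto
  moreover have "bdd_below S"
    unfolding S_def using superlevel_bdd_below[OF shift cont W]
    by (subst bdd_below_UN) auto
  moreover have "S \<noteq> {}"
  proof -
    obtain n :: nat where "z 0 - X 0 0 \<le> real n * W"
      using reals_Archimedean3[OF W] by (metis less_imp_le)
    then have "z 0 \<le> X (0 + of_int (int n)) 0"
      using loop_translate_int[of "\<lambda>a. X a 0" W 0 "int n"] shift by simp
    then show ?thesis using k by (auto simp: S_def)
  qed
  ultimately have b: "Inf S \<in> S" "\<And>a. a < Inf S \<Longrightarrow> a \<notin> S"
    using closed_contains_Inf cInf_lower not_le by (blast, metis)
  define b where "b = Inf S"
  have before: "X a i < z i" if "a < b" for a i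
    using less b(2) that by (simp add: b_def)
  have le: "X b i \<le> z i" for i
  proof (rule tendsto_upperbound)
    show "((\<lambda>a. X a i) \<longlongrightarrow> X b i) (at_left b)"
      using cont[of i] by (simp add: continuous_on_def filterlim_at_split)
    show "\<forall>\<^sub>F a in at_left b. X a i \<le> z i"
      unfolding eventually_at_filter
      by (intro always_eventually) (use before in \<open>auto intro: less_imp_le\<close>)
  qed simp
  obtain j where "z j \<le> X b j" using b(1) by (auto simp: S_def b_def)
  then have "X b = z"
    by (intro periodic_configurations_touching[OF k X z le, of j] antisym le)
  then show thesis by (rule that) (rule before)
qed

text \<open>Compare the two times at which the family first hits \<open>x\<close> and \<open>y\<close>: until a configuration is first hit,
  the family stays strictly below it, so the one hit first lies strictly below the other. For negative \<open>W\<close> the family is run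
  backwards.\<close>

lemma periodic_configurations_ordered:
  fixes X :: "real \<Rightarrow> nat \<Rightarrow> real"
  assumes k: "k > 0" and X: "\<And>a. periodic_configuration k R (X a)"
    and cont: "\<And>i. continuous_on UNIV (\<lambda>a. X a i)"
    and shift: "\<And>a i. X (a + 1) i = X a i + W" and W: "W \<noteq> 0"
    and x: "periodic_configuration k R x" and y: "periodic_configuration k R y"
  shows "x = y \<or> (\<forall>i. x i < y i) \<or> (\<forall>i. y i < x i)"
proof -
  have main: ?thesis
    if X: "\<And>a. periodic_configuration k R (X a)"
    and cont: "\<And>i. continuous_on UNIV (\<lambda>a. X a i)"
    and shift: "\<And>a i. X (a + 1) i = X a i + W" and W: "W > 0" for X :: "real \<Rightarrow> nat \<Rightarrow> real" and W
  proof -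
    obtain b c where b: "X b = x" "\<And>a i. a < b \<Longrightarrow> X a i < x i"
      and c: "X c = y" "\<And>a i. a < c \<Longrightarrow> X a i < y i"
      using first_hitting[OF k X cont shift W] x y by metis
    then show ?thesis by (cases b c rule: linorder_cases) auto
  qed
  show ?thesis
  proof (cases "W > 0")
    case True
    then show ?thesis using main[of X W] X cont shift by blast
  next
    case False
    show ?thesis
    proof (rule main[of "\<lambda>a. X (- a)" "- W"])
      show "X (- (a + 1)) i = X (- a) i + - W" for a i
        using shift[of "- a - 1" i] by simp
      show "continuous_on UNIV (\<lambda>a. X (- a) i)" for i
        by (intro continuous_on_compose2[OF cont] continuous_intros) auto
    qed (use X False W in auto)
  qed
qed

text \<open>The shifted and translated sequence \<open>y\<close> has the same type as \<open>x\<close> and the same mean position, so it can be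
  neither strictly above nor strictly below \<open>x\<close>. The total order leaves only \<open>x = y\<close>.\<close>

lemma periodic_configuration_equidistant:
  fixes X :: "real \<Rightarrow> nat \<Rightarrow> real"
  assumes k: "k > 0" and X: "\<And>a. periodic_configuration k R (X a)"
    and cont: "\<And>i. continuous_on UNIV (\<lambda>a. X a i)"
    and shift: "\<And>a i. X (a + 1) i = X a i + W" and W: "W \<noteq> 0"
    and sym: "\<And>s t. chord_cos (s - R / k) (t - R / k) = chord_cos s t"
    and x: "periodic_configuration k R x"
  shows "x (Suc i) = x i + R / k"
proof -
  define y where "y i = x (Suc i) - R / k" for i
  have y: "periodic_configuration k R y"
    using x by (auto simp: periodic_configuration_def stationary_def y_def sym)
      (metis add_Suc)
  have sum: "(\<Sum>i<k. y i - x i) = 0"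
  proof -
    have "(\<Sum>i<k. y i - x i) = (\<Sum>i<k. x (Suc i) - x i) - R"
      using k by (simp add: y_def sum_subtractf sum.distrib algebra_simps)
    also have "\<dots> = x k - x 0 - R"
      by (simp add: sum_lessThan_telescope)
    finally show ?thesis
      using x[unfolded periodic_configuration_def] by (metis add_0 add_diff_cancel_left' diff_self)
  qed
  have "x = y"
  proof (rule ccontr)
    assume "x \<noteq> y"
    then consider "\<And>i. x i < y i" | "\<And>i. y i < x i"
      using periodic_configurations_ordered[OF k X cont shift W x y] by blast
    then show False
    proof cases
      case 1
      have "(\<Sum>i<k. y i - x i) > 0" by (intro sum_pos) (use k 1 in auto)
      then show False using sum by simp
    next
      case 2
      have "(\<Sum>i<k. x i - y i) > 0" by (intro sum_pos) (use k 2 in auto)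
      then show False using sum by (simp add: sum_subtractf)
    qed
  qed
  then have "x i = x (Suc i) - R / k" by (metis y_def)
  then show ?thesis by simp
qed

section \<open>The configurations of an invariant curve\<close>

text \<open>The arc length parameter modulo \<open>l\<close> as a continuous function of the point, with values in the unit circle.
  Continuity holds because \<open>\<gamma>\<close> is a closed map on the compact interval \<open>{0..l}\<close>. The choice of a parameter
  in the definition of \<open>h\<close> is harmless since parameters of one point differ by multiples of \<open>l\<close>.\<close>

lemma curve_angle_function:
  obtains h :: "complex \<Rightarrow> complex" where "continuous_on (range \<gamma>) h"
    "\<And>s. h (\<gamma> s) = cis (2 * pi * s / l)"
proof
  define h where "h z = cis (2 * pi * (SOME s. \<gamma> s = z) / l)" for z
  show h: "h (\<gamma> s) = cis (2 * pi * s / l)" for s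
  proof -
    have "\<gamma> (SOME t. \<gamma> t = \<gamma> s) = \<gamma> s" by (rule someI[of _ s]) simp
    then obtain n :: int where "s = (SOME t. \<gamma> t = \<gamma> s) + of_int n * l"
      by (auto simp: curve_eq_iff)
    then have "2 * pi * s / l = 2 * pi * (SOME t. \<gamma> t = \<gamma> s) / l + 2 * pi * of_int n"
      using l_pos by (metis (no_types, lifting) add_divide_distrib distrib_left mult.assoc
          nonzero_mult_div_cancel_right less_irrefl)
    then show ?thesis
      by (simp add: h_def flip: cis_mult)
  qed
  have cl: "compact (range \<gamma>)"
    unfolding range_curve by (intro compact_continuous_image continuous_on_curve) auto
  show "continuous_on (range \<gamma>) h"
    unfolding continuous_on_closed_vimage[OF compact_imp_closed[OF cl]]
  proof safe
    fix B :: "complex set" assume "closed B"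
    have "h -` B \<inter> range \<gamma> = \<gamma> ` ({0..l} \<inter> (\<lambda>s. cis (2 * pi * s / l)) -` B)"
      using h range_curve by auto
    moreover have "closed ((\<lambda>s. cis (2 * pi * s / l)) -` B)"
      using l_pos by (intro closed_vimage[OF \<open>closed B\<close>] continuous_intros) auto
    ultimately show "closed (h -` B \<inter> range \<gamma>)"
      by (auto intro!: compact_imp_closed compact_continuous_image continuous_on_curve compact_Int_closed)
  qed
qed

text \<open>The arc length parametrization is a covering of the curve; the lift is the imaginary part of a continuous
  logarithm of the angle function along \<open>q\<close>.\<close>

lemma curve_lift:
  fixes q :: "real \<Rightarrow> complex"
  assumes q: "continuous_on UNIV q" "range q \<subseteq> range \<gamma>"
  obtains \<sigma> :: "real \<Rightarrow> real" where "continuous_on UNIV \<sigma>" "\<And>t. \<gamma> (\<sigma> t) = q t"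
proof -
  obtain h where h: "continuous_on (range \<gamma>) h" "\<And>s. h (\<gamma> s) = cis (2 * pi * s / l)"
    using curve_angle_function by blast
  have "continuous_on UNIV (\<lambda>t. h (q t))"
    by (rule continuous_on_compose2[OF h(1) q(1)]) (use q in auto)
  moreover have "h (q t) \<noteq> 0" for t
  proof -
    obtain s where "q t = \<gamma> s" using q by blast
    then show ?thesis by (simp add: h)
  qed
  ultimately obtain g where g: "continuous_on UNIV g" "\<And>t. h (q t) = exp (g t)"
    using continuous_logarithm_on_contractible[of UNIV "\<lambda>t. h (q t)"]
      convex_imp_contractible[OF convex_UNIV] by auto
  show ?thesis
  proof
    show "continuous_on UNIV (\<lambda>t. l * Im (g t) / (2 * pi))"
      by (intro continuous_intros g) auto
    fix t
    obtain s where s: "q t = \<gamma> s" using q by blast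
    then have "exp (g t) = exp (\<i> * of_real (2 * pi * s / l))"
      using g(2)[of t] h(2)[of s] by (simp add: cis_conv_exp)
    then obtain n :: int where "g t = \<i> * of_real (2 * pi * s / l) + of_int (2 * n) * pi * \<i>"
      unfolding exp_eq by blast
    then have "Im (g t) = 2 * pi * s / l + 2 * of_int n * pi"
      by simp
    then have "l * Im (g t) / (2 * pi) = s + of_int n * l"
      using l_pos by (simp add: field_simps)
    then show "\<gamma> (l * Im (g t) / (2 * pi)) = q t"
      by (simp add: periodic_int s)
  qed
qed

text \<open>The lift of the invariant curve. Turn numbers and winding number are integers that vary continuously
  along the curve, hence constant. If the winding number vanished, the lift to the strip over the phase
  cylinder would be a loop, and contracting it in this convex strip would contract the invariant curve.\<close>

lemma lifted_invariant_curve: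
  assumes k: "k > 0" and C: "rotational_invariant_curve_of_periodic_orbits \<gamma> k C"
  obtains X :: "real \<Rightarrow> nat \<Rightarrow> real" and r :: int and W :: real where
    "\<And>a. periodic_configuration k (of_int r * l) (X a)"
    "\<And>i. continuous_on UNIV (\<lambda>a. X a i)"
    "\<And>a i. X (a + 1) i = X a i + W" "W \<noteq> 0"
proof -
  obtain c where c: "simple_path c" "pathfinish c = pathstart c" "path_image c = C"
    "C \<subseteq> phase_cylinder \<gamma>" "\<And>a. \<not> homotopic_loops (phase_cylinder \<gamma>) c (linepath a a)"
    and period: "\<And>x. x \<in> C \<Longrightarrow> minimal_period (billiard_map \<gamma>) k x"
    using C unfolding rotational_invariant_curve_of_periodic_orbits_def
      rotational_invariant_curve_def by blast
  then have "path c" by (simp add: simple_path_imp_path)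
  obtain q where q: "continuous_on UNIV q" "\<And>t. q (t + 1) = q t" "range q \<subseteq> C"
    "\<And>t. t \<in> {0..1} \<Longrightarrow> q t = c t"
    using loop_periodic_extension[OF \<open>path c\<close> c(2)] c(3) by metis
  have qC: "q a \<in> C" for a using q(3) by blast
  have cyl: "fst (q a) \<in> range \<gamma>" "0 < snd (q a)" "snd (q a) < pi" for a
    using qC[of a] c(4) by (auto simp: phase_cylinder_def)
  obtain \<sigma> where \<sigma>: "continuous_on UNIV \<sigma>" "\<And>t. \<gamma> (\<sigma> t) = fst (q t)"
    using curve_lift[of "\<lambda>t. fst (q t)"] q(1) cyl by (auto intro: continuous_on_fst)
  define P where "P a = (\<sigma> a, cos (snd (q a)))" for a
  have P: "\<bar>snd (P a)\<bar> < 1" for a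
    using cos_monotone_0_pi[of 0 "snd (q a)"] cos_monotone_0_pi[of "snd (q a)" pi] cyl[of a]
    by (auto simp: P_def abs_less_iff)
  have contP: "continuous_on UNIV P"
    unfolding P_def by (intro continuous_intros \<sigma> q)
  have phase: "phase_point (P a) = q a" for a
    using cyl[of a] by (simp add: phase_point_def P_def \<sigma> arccos_cos prod_eq_iff)
  define X where "X a i = fst ((lifted_map ^^ i) (P a))" for a i
  have contX: "continuous_on UNIV (\<lambda>a. X a i)" for i
    unfolding X_def by (intro continuous_on_fst continuous_on_lifted_map_funpow contP P)
  have ex: "\<exists>n::int. (lifted_map ^^ k) (P a) = P a + (of_int n * l, 0)" for a
    using lifted_map_period[OF P[of a]] period[OF qC[of a]]
    by (metis phase minimal_period_def)
  have "\<exists>r::int. \<forall>a. X a k - \<sigma> a = of_int r * l"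
  proof (rule continuous_integer_multiple_constant)
    show "continuous_on UNIV (\<lambda>a. X a k - \<sigma> a)" by (intro continuous_intros contX \<sigma>)
    show "\<exists>n::int. X a k - \<sigma> a = of_int n * l" for a
      using ex[of a] by (auto simp: X_def P_def)
  qed (rule l_pos)
  then obtain r :: int where r: "\<And>a. X a k - \<sigma> a = of_int r * l" by blast
  have Pk: "(lifted_map ^^ k) (P a) = P a + (of_int r * l, 0)" for a
    using ex[of a] r[of a] by (auto simp: X_def P_def prod_eq_iff)
  have conf: "periodic_configuration k (of_int r * l) (X a)" for a
    unfolding periodic_configuration_def
  proof (intro conjI allI)
    show "stationary (X a)"
      unfolding X_def[abs_def] by (rule stationary_lifted_orbit[OF P])
    show "X a (i + k) = X a i + of_int r * l" for i
      by (simp add: X_def funpow_add Pk lifted_map_funpow_translate P)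
  qed
  have "\<exists>m::int. \<forall>a. \<sigma> (a + 1) - \<sigma> a = of_int m * l"
  proof (rule continuous_integer_multiple_constant)
    show "continuous_on UNIV (\<lambda>a. \<sigma> (a + 1) - \<sigma> a)"
      by (intro continuous_intros \<sigma> continuous_on_compose2[OF \<sigma>(1)]) auto
    show "\<exists>n::int. \<sigma> (a + 1) - \<sigma> a = of_int n * l" for a
    proof -
      have "\<gamma> (\<sigma> a) = \<gamma> (\<sigma> (a + 1))" by (simp add: \<sigma> q)
      then show ?thesis by (auto simp: curve_eq_iff)
    qed
  qed (rule l_pos)
  then obtain m :: int where m: "\<And>a. \<sigma> (a + 1) - \<sigma> a = of_int m * l" by blast
  have "P (a + 1) = P a + (of_int m * l, 0)" for a
    using m[of a] q(2)[of a] by (simp add: P_def algebra_simps)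
  then have shift: "X (a + 1) i = X a i + of_int m * l" for a i
    by (simp add: X_def lifted_map_funpow_translate P)
  \<comment> \<open>\<open>D\<close> lifts the curve to the strip \<open>S\<close>, on which the angle itself is the second coordinate.\<close>
  have "m \<noteq> 0"
  proof
    assume "m = 0"
    define D where "D a = (\<sigma> a, snd (q a))" for a
    define S where "S = (UNIV :: real set) \<times> {0<..<pi}"
    have "continuous_on UNIV D"
      unfolding D_def by (intro continuous_intros \<sigma> q)
    then have "path D" unfolding path_def using continuous_on_subset by blast
    moreover have "path_image D \<subseteq> S"
      using cyl by (auto simp: path_image_def D_def S_def)
    moreover have "pathfinish D = pathstart D"
      using m[of 0] q(2)[of 0] \<open>m = 0\<close> by (simp add: D_def pathfinish_def pathstart_def)
    moreover have "simply_connected S"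
      unfolding S_def by (intro convex_imp_simply_connected convex_Times) auto
    moreover have "D 0 \<in> S" using cyl by (simp add: D_def S_def)
    ultimately have "homotopic_loops S D (linepath (D 0) (D 0))"
      using simply_connected_eq_contractible_loop_any by blast
    moreover have "continuous_on S (\<lambda>p. (\<gamma> (fst p), snd p))"
      by (intro continuous_intros continuous_on_compose2[OF continuous_on_curve[of UNIV]]) auto
    moreover have "(\<lambda>p. (\<gamma> (fst p), snd p)) \<in> S \<rightarrow> phase_cylinder \<gamma>"
      by (auto simp: S_def phase_cylinder_def)
    ultimately have "homotopic_loops (phase_cylinder \<gamma>) ((\<lambda>p. (\<gamma> (fst p), snd p)) \<circ> D)
        ((\<lambda>p. (\<gamma> (fst p), snd p)) \<circ> linepath (D 0) (D 0))"
      by (rule homotopic_loops_continuous_image)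
    moreover have "(\<lambda>p. (\<gamma> (fst p), snd p)) \<circ> D = q"
      by (auto simp: D_def \<sigma>)
    moreover have "(\<lambda>p. (\<gamma> (fst p), snd p)) \<circ> linepath (D 0) (D 0) = linepath (q 0) (q 0)"
      by (auto simp: linepath_refl D_def \<sigma>)
    moreover have "homotopic_loops (phase_cylinder \<gamma>) c q"
      by (rule homotopic_loops_eq) (use \<open>path c\<close> c q in auto)
    ultimately show False
      using c(5) homotopic_loops_trans by metis
  qed
  then show thesis
    using that[OF conf contX shift] l_pos by simp
qed

section \<open>The rotational symmetry\<close>

definition rotates :: "complex \<Rightarrow> real \<Rightarrow> bool" where
  "rotates w t \<longleftrightarrow> norm w = 1 \<and> (\<forall>s. \<gamma> (s + t) = w * \<gamma> s)"

lemma rotates_add: "rotates w t \<Longrightarrow> rotates w' t' \<Longrightarrow> rotates (w * w') (t + t')"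
  by (simp add: rotates_def norm_mult add.assoc[symmetric] mult_ac)

lemma rotates_minus:
  assumes "rotates w t"
  shows "rotates (inverse w) (- t)"
proof -
  have "w \<noteq> 0" using assms by (auto simp: rotates_def)
  moreover have "\<gamma> s = w * \<gamma> (s + - t)" for s
    using assms[unfolded rotates_def, THEN conjunct2, rule_format, of "s - t"] by simp
  ultimately have "\<gamma> (s + - t) = inverse w * \<gamma> s" for s
    by (metis mult.assoc left_inverse mult_1)
  then show ?thesis
    using assms by (simp add: rotates_def norm_inverse)
qed

lemma rotates_nat: "rotates w t \<Longrightarrow> rotates (w ^ n) (real n * t)"
proof (induction n)
  case (Suc n)
  then show ?case using rotates_add[of w t "w ^ n" "real n * t"] by (simp add: distrib_right)
qed (simp add: rotates_def)

lemma rotates_int: "rotates w t \<Longrightarrow> \<exists>w'. rotates w' (of_int n * t)"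
  using rotates_nat[of w t "nat n"] rotates_minus[OF rotates_nat[of w t "nat (- n)"]]
  by (cases "n \<ge> 0") auto

lemma rotates_length: "rotates 1 l"
  by (simp add: rotates_def periodic)

lemma tangent_rotates:
  assumes "rotates w t"
  shows "tangent (s + t) = w * tangent s"
proof -
  have "((\<gamma> \<circ> (\<lambda>x. x + t)) has_vector_derivative 1 *\<^sub>R tangent (s + t)) (at s)"
    by (rule vector_diff_chain_at) (auto intro!: derivative_eq_intros has_tangent)
  moreover have "\<gamma> \<circ> (\<lambda>x. x + t) = (\<lambda>x. w * \<gamma> x)"
    using assms by (auto simp: rotates_def)
  moreover have "((\<lambda>x. w * \<gamma> x) has_vector_derivative w * tangent s) (at s)"
    by (intro has_vector_derivative_mult_right has_tangent)
  ultimately show ?thesis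
    using vector_derivative_unique_at by fastforce
qed

lemma chord_cos_rotates:
  assumes "rotates w c"
  shows "chord_cos (s - c) (t - c) = chord_cos s t"
proof -
  have w: "norm w = 1" "\<And>s. \<gamma> (s + c) = w * \<gamma> s"
    using assms by (auto simp: rotates_def)
  have "chord_cos (s + c) (t + c) = chord_cos s t" for s t
    using w by (simp add: chord_cos_def tangent_rotates[OF assms] inner_mult_unit norm_mult
        flip: right_diff_distrib)
  from this[of "s - c" "t - c"] show ?thesis by simp
qed

text \<open>A rotation maps the curve to itself preserving arc length, so in the parameter it is a translation or a
  reflection. The derivative of \<open>\<sigma>\<close> exists because \<open>t \<mapsto> inner v (\<gamma> t)\<close>, with \<open>v\<close> the tangent at \<open>\<gamma> (\<sigma> s)\<close>, is a
  local coordinate of the curve whose derivative there is \<open>1\<close>; its absolute value is \<open>1\<close> because both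
  parametrizations have unit speed, and its sign is constant by continuity.\<close>

lemma curve_isometry_parameter:
  assumes cont: "continuous_on UNIV \<sigma>" and w: "norm w = 1" and \<sigma>: "\<And>s. \<gamma> (\<sigma> s) = w * \<gamma> s"
  obtains d where "d = 1 \<or> d = -1" "\<And>s. \<sigma> s = \<sigma> 0 + d * s"
proof -
  define D where "D s = inner (tangent (\<sigma> s)) (w * tangent s)" for s
  have w_deriv: "((\<lambda>t. w * \<gamma> t) has_vector_derivative w * tangent s) (at s)" for s
    by (intro has_vector_derivative_mult_right has_tangent)
  have D: "DERIV \<sigma> s :> D s" for s
  proof -
    define v where "v = tangent (\<sigma> s)"
    have "DERIV (\<lambda>t. inner v (\<gamma> t)) (\<sigma> s) :> inner v v"
      using bounded_linear.has_vector_derivative[OF bounded_linear_inner_right has_tangent]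
      by (simp add: has_real_derivative_iff_has_vector_derivative v_def)
    moreover have "inner v v = 1" by (simp add: v_def dot_square_norm)
    ultimately obtain g where g: "\<And>z. inner v (\<gamma> z) - inner v (\<gamma> (\<sigma> s)) = g z * (z - \<sigma> s)"
      "isCont g (\<sigma> s)" "g (\<sigma> s) = 1"
      unfolding CARAT_DERIV by auto
    have "DERIV (\<lambda>t. inner v (w * \<gamma> t)) s :> D s"
      using bounded_linear.has_vector_derivative[OF bounded_linear_inner_right w_deriv]
      by (simp add: has_real_derivative_iff_has_vector_derivative v_def D_def)
    then obtain f where f: "\<And>z. inner v (w * \<gamma> z) - inner v (w * \<gamma> s) = f z * (z - s)"
      "isCont f s" "f s = D s"
      unfolding CARAT_DERIV by auto
    have eq: "g (\<sigma> t) * (\<sigma> t - \<sigma> s) = f t * (t - s)" for t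
      using g(1)[of "\<sigma> t"] f(1)[of t] by (simp add: \<sigma>)
    have "isCont \<sigma> s" using cont by (simp add: continuous_on_eq_continuous_at)
    then have lim: "((\<lambda>t. g (\<sigma> t)) \<longlongrightarrow> 1) (at s)"
      using isCont_tendsto_compose[OF g(2), of \<sigma> "at s"] g(3) by (simp add: isCont_def)
    then have "\<forall>\<^sub>F t in at s. 0 < g (\<sigma> t)"
      by (rule order_tendstoD) simp
    moreover have "\<forall>\<^sub>F t in at s. t \<noteq> s" by (simp add: eventually_at_filter)
    ultimately have "\<forall>\<^sub>F t in at s. f t / g (\<sigma> t) = (\<sigma> t - \<sigma> s) / (t - s)"
    proof eventually_elim
      case (elim t)
      then show ?case using eq[of t] by (simp add: field_simps)
    qed
    moreover have "((\<lambda>t. f t / g (\<sigma> t)) \<longlongrightarrow> D s / 1) (at s)"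
      using f(2,3) lim by (intro tendsto_divide) (auto simp: isCont_def)
    ultimately show ?thesis
      unfolding has_field_derivative_iff using Lim_transform_eventually by force
  qed
  have absD: "\<bar>D s\<bar> = 1" for s
  proof -
    have "((\<gamma> \<circ> \<sigma>) has_vector_derivative D s *\<^sub>R tangent (\<sigma> s)) (at s)"
      by (rule vector_diff_chain_at[OF _ has_tangent])
        (use D in \<open>simp add: has_real_derivative_iff_has_vector_derivative\<close>)
    moreover have "\<gamma> \<circ> \<sigma> = (\<lambda>t. w * \<gamma> t)" using \<sigma> by auto
    ultimately have "D s *\<^sub>R tangent (\<sigma> s) = w * tangent s"
      using vector_derivative_unique_at w_deriv by metis
    then have "norm (D s *\<^sub>R tangent (\<sigma> s)) = norm (w * tangent s)" by simp
    then show ?thesis by (simp add: norm_mult w)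
  qed
  have "\<exists>n::int. \<forall>s. D s = of_int n * 1"
  proof (rule continuous_integer_multiple_constant)
    show "continuous_on UNIV D"
      unfolding D_def
      by (intro continuous_intros continuous_on_tangent continuous_on_compose2[OF continuous_on_tangent cont]) auto
    show "\<exists>n::int. D s = of_int n * 1" for s
      using absD[of s] by (intro exI[of _ "if D s \<ge> 0 then 1 else - 1"]) auto
  qed simp
  then obtain n :: int where n: "\<And>s. D s = of_int n" by auto
  define d :: real where "d = of_int n"
  have "DERIV (\<lambda>s. \<sigma> s - d * s) s :> 0" for s
    using D[of s] n[of s] by (auto intro!: derivative_eq_intros simp: d_def)
  then have "\<sigma> s - d * s = \<sigma> 0 - d * 0" for s
    using DERIV_isconst_all[of "\<lambda>s. \<sigma> s - d * s"] by blast
  moreover have "d = 1 \<or> d = -1" using absD[of 0] n[of 0] by (auto simp: d_def abs_if split: if_splits)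
  ultimately show ?thesis using that[of d] by (metis add_diff_cancel diff_add_cancel mult_zero_right diff_zero)
qed

text \<open>A reflection of the parameter is impossible: its two fixed points, half a period apart, would be two
  points of the curve fixed by the rotation, and the rotation fixes only the origin.\<close>

lemma rotation_shifts_parameter:
  assumes w: "norm w = 1" "w \<noteq> 1" and inv: "(\<lambda>z. w * z) ` range \<gamma> \<subseteq> range \<gamma>"
  obtains c where "rotates w c"
proof -
  have "continuous_on UNIV (\<lambda>s. w * \<gamma> s)"
    by (intro continuous_intros continuous_on_curve)
  moreover have "range (\<lambda>s. w * \<gamma> s) \<subseteq> range \<gamma>" using inv by auto
  ultimately obtain \<sigma> where \<sigma>: "continuous_on UNIV \<sigma>" "\<And>s. \<gamma> (\<sigma> s) = w * \<gamma> s"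
    using curve_lift[of "\<lambda>s. w * \<gamma> s"] by blast
  obtain d where d: "d = 1 \<or> d = -1" "\<And>s. \<sigma> s = \<sigma> 0 + d * s"
    using curve_isometry_parameter[OF \<sigma>(1) w(1) \<sigma>(2)] by blast
  have "d \<noteq> -1"
  proof
    assume "d = -1"
    have fix0: "\<gamma> s = 0" if "\<gamma> (\<sigma> s) = \<gamma> s" for s
      using \<sigma>(2)[of s] that w(2) by auto
    have "\<sigma> (\<sigma> 0 / 2) = \<sigma> 0 / 2"
      using d(2)[of "\<sigma> 0 / 2"] \<open>d = -1\<close> by (simp add: field_simps)
    then have "\<gamma> (\<sigma> 0 / 2) = 0" by (intro fix0 arg_cong[where f = \<gamma>])
    moreover have "\<gamma> ((\<sigma> 0 + l) / 2) = 0"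
    proof (rule fix0)
      have "\<sigma> ((\<sigma> 0 + l) / 2) + l = (\<sigma> 0 + l) / 2"
        using d(2)[of "(\<sigma> 0 + l) / 2"] \<open>d = -1\<close> by (simp add: field_simps)
      then show "\<gamma> (\<sigma> ((\<sigma> 0 + l) / 2)) = \<gamma> ((\<sigma> 0 + l) / 2)"
        using periodic by metis
    qed
    moreover have "\<gamma> (\<sigma> 0 / 2) \<noteq> \<gamma> ((\<sigma> 0 + l) / 2)"
      using l_pos by (intro curve_neq) (auto simp: field_simps)
    ultimately show False by simp
  qed
  then have "\<gamma> (s + \<sigma> 0) = w * \<gamma> s" for s
    using d \<sigma>(2)[of s] by (metis add.commute mult_1)
  then show ?thesis using that w by (auto simp: rotates_def)
qed

text \<open>The rotation of order \<open>k\<close> translates the parameter by \<open>c\<close> with \<open>k * c = m * l\<close>. Here \<open>m\<close> is coprime to \<open>k\<close>: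
  for a common divisor \<open>g\<close>, the power \<open>k / g\<close> of the rotation translates by a multiple of \<open>l\<close>, so it is the
  identity and \<open>g = 1\<close>. By Bezout's identity \<open>l / k\<close> is then an integer combination of \<open>c\<close> and \<open>l\<close>.\<close>

lemma rotates_length_div:
  assumes k: "k \<ge> 2" and inv: "rotation (2 * pi / real k) ` range \<gamma> = range \<gamma>"
  obtains w where "rotates w (of_int r * l / real k)"
proof -
  define \<rho> where "\<rho> = cis (2 * pi / k)"
  have "real k * (2 * pi / real k) = 2 * pi" using k by simp
  then have \<rho>: "norm \<rho> = 1" "\<rho> \<noteq> 1" "\<rho> ^ k = 1"
    using cis_root_neq_1[OF k] by (simp_all only: \<rho>_def Complex.DeMoivre cis_2pi norm_cis not_False_eq_True)
  have "rotation (2 * pi / real k) = (\<lambda>z. \<rho> * z)"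
    by (auto simp: rotation_def \<rho>_def)
  then obtain c where c: "rotates \<rho> c"
    using rotation_shifts_parameter[OF \<rho>(1,2)] inv by (metis order_refl)
  obtain s0 where s0: "\<gamma> s0 \<noteq> 0"
    using curve_neq[of 0 "l / 2"] l_pos by fastforce
  have "\<gamma> 0 = \<gamma> (0 + real k * c)"
    using rotates_nat[OF c, of k] \<rho>(3) unfolding rotates_def by (metis mult_1)
  then obtain m :: int where m: "real k * c = of_int m * l"
    by (auto simp: curve_eq_iff)
  define g where "g = gcd m (int k)"
  have "g > 0" using k by (auto simp: g_def)
  then obtain g' where g': "g = int g'" "g' > 0" by (metis pos_int_cases)
  have "g = 1"
  proof (rule ccontr)
    assume "g \<noteq> 1"
    then have "g' \<ge> 2" using g' by auto
    obtain m' k' where mk: "m = g * m'" "int k = g * k'"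
      unfolding g_def by (metis dvdE gcd_dvd1 gcd_dvd2)
    then have "k' \<ge> 0" using g' k by (metis \<open>g > 0\<close> of_nat_0_le_iff zero_le_mult_iff not_le)
    then obtain k'' where k'': "k' = int k''" by (metis nonneg_int_cases)
    have kk: "k = g' * k''" using mk(2) unfolding g' k'' by (metis of_nat_eq_iff of_nat_mult)
    then have "k'' > 0" using k by (cases k'') auto
    have "real g' * (real k'' * c) = real g' * (of_int m' * l)"
      using m unfolding kk mk(1) g' by (simp add: mult_ac)
    then have "real k'' * c = of_int m' * l" using g' by simp
    then have "\<rho> ^ k'' * \<gamma> s0 = \<gamma> s0"
      using rotates_nat[OF c, of k''] periodic_int unfolding rotates_def by metis
    then have "\<rho> ^ k'' = 1" using s0 by simp
    moreover have "\<rho> ^ k'' = cis (2 * pi / g')"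
      using \<open>k'' > 0\<close> by (simp add: \<rho>_def Complex.DeMoivre kk)
    ultimately show False using cis_root_neq_1[OF \<open>g' \<ge> 2\<close>] by simp
  qed
  then obtain p q where pq: "p * m + q * int k = 1"
    using bezout_int[of m "int k"] by (auto simp: g_def)
  have "real_of_int p * (of_int m * l) + of_int q * (real k * l) = real_of_int (p * m + q * int k) * l"
    by (simp add: algebra_simps)
  then have "real k * (of_int p * c + of_int q * l) = l"
    unfolding pq m[symmetric] by (simp add: algebra_simps)
  then have "l / real k = of_int p * c + of_int q * l"
    using k by (simp add: field_simps)
  then obtain w where "rotates w (l / real k)"
    using rotates_int[OF c, of p] rotates_int[OF rotates_length, of q] rotates_add by metis
  then show ?thesis
    using rotates_int[of w "l / real k" r] that by auto
qed

text \<open>The radius is constant, say \<open>r\<close>, and the quotient \<open>tangent s / \<gamma> s\<close> is purely imaginary of modulus \<open>1 / r\<close>. By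
  continuity it is constant, so \<open>\<gamma>\<close> is an exponential that runs through the whole circle.\<close>

lemma circle_if_radius_orthogonal:
  assumes orth: "\<And>s. inner (\<gamma> s) (tangent s) = 0"
  shows "is_circle (range \<gamma>)"
proof -
  have "((\<lambda>s. inner (\<gamma> s) (\<gamma> s)) has_vector_derivative 0) (at s)" for s
    using bounded_bilinear.has_vector_derivative[OF bounded_bilinear_inner has_tangent[of s] has_tangent[of s]]
      orth[of s] by (simp add: inner_commute)
  then obtain e where e: "\<And>s. inner (\<gamma> s) (\<gamma> s) = e"
    using has_vector_derivative_zero_constant[of UNIV "\<lambda>s. inner (\<gamma> s) (\<gamma> s)"]
    by (metis UNIV_I convex_UNIV has_vector_derivative_at_within)
  define r where "r = sqrt e"
  have r: "norm (\<gamma> s) = r" for s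
    by (simp add: r_def norm_eq_sqrt_inner e)
  obtain s0 where "\<gamma> s0 \<noteq> 0"
    using curve_neq[of 0 "l / 2"] l_pos by fastforce
  then have "r > 0" using r by (metis zero_less_norm_iff)
  then have nz: "\<gamma> s \<noteq> 0" for s using r[of s] by auto
  have z: "Re (tangent s / \<gamma> s) = 0" "\<bar>Im (tangent s / \<gamma> s)\<bar> = 1 / r" for s
  proof -
    show "Re (tangent s / \<gamma> s) = 0"
      using orth[of s] by (simp add: Re_divide inner_complex_def mult.commute)
    then show "\<bar>Im (tangent s / \<gamma> s)\<bar> = 1 / r"
      using cmod_eq_Im[of "tangent s / \<gamma> s"] by (simp add: norm_divide r)
  qed
  have "\<exists>n::int. \<forall>s. Im (tangent s / \<gamma> s) = of_int n * (1 / r)"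
  proof (rule continuous_integer_multiple_constant)
    show "continuous_on UNIV (\<lambda>s. Im (tangent s / \<gamma> s))"
      by (intro continuous_intros continuous_on_tangent continuous_on_curve) (use nz in auto)
    show "\<exists>n::int. Im (tangent s / \<gamma> s) = of_int n * (1 / r)" for s
      using z(2)[of s] by (intro exI[of _ "if Im (tangent s / \<gamma> s) \<ge> 0 then 1 else - 1"]) auto
  qed (use \<open>r > 0\<close> in simp)
  then obtain n :: int where n: "\<And>s. Im (tangent s / \<gamma> s) = of_int n * (1 / r)" by blast
  define y where "y = of_int n * (1 / r)"
  have y: "y \<noteq> 0" using z(2)[of 0] n[of 0] \<open>r > 0\<close> by (auto simp: y_def)
  have tangent: "tangent s = \<i> * of_real y * \<gamma> s" for s
  proof -
    have "tangent s / \<gamma> s = \<i> * of_real y"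
      using z(1)[of s] n[of s] by (simp add: complex_eq_iff y_def)
    then show ?thesis using nz[of s] by (simp add: field_simps)
  qed
  have "((\<lambda>s. \<gamma> s * cis (- y * s)) has_vector_derivative 0) (at s)" for s
  proof -
    have "((\<lambda>s. cis (- y * s)) has_vector_derivative (- y) *\<^sub>R (\<i> * cis (- y * s))) (at s)"
    proof -
      have "((\<lambda>x. exp (\<i> * of_real (- y * x))) has_vector_derivative (- y) *\<^sub>R (\<i> * cis (- y * s))) (at s)"
        by (auto intro!: derivative_eq_intros has_vector_derivative_real_field simp: cis_conv_exp scaleR_conv_of_real)
      then show ?thesis by (simp add: cis_conv_exp)
    qed
    from has_vector_derivative_mult[OF has_tangent[of s] this]
    show ?thesis by (simp add: tangent scaleR_conv_of_real)
  qed
  then obtain b where b: "\<And>s. \<gamma> s * cis (- y * s) = b"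
    using has_vector_derivative_zero_constant[of UNIV "\<lambda>s. \<gamma> s * cis (- y * s)"]
    by (metis UNIV_I convex_UNIV has_vector_derivative_at_within)
  have param: "\<gamma> s = b * cis (y * s)" for s
    using b[of s] by (simp add: mult.assoc cis_mult flip: b[of s])
  have "norm b = r" using r[of 0] param[of 0] by simp
  have "z \<in> range \<gamma>" if "norm z = r" for z
  proof -
    have "norm (z / b) = 1" using that \<open>norm b = r\<close> \<open>r > 0\<close> by (simp add: norm_divide)
    then obtain \<theta> where "z / b = cis \<theta>"
      by (metis complex_norm_eq_1_exp cis_conv_exp)
    then have "z = b * cis \<theta>" using \<open>norm b = r\<close> \<open>r > 0\<close> by (auto simp: field_simps)
    then have "z = \<gamma> (\<theta> / y)" using y by (simp add: param)
    then show ?thesis by blast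
  qed
  then have "range \<gamma> = sphere 0 r" using r by auto
  then show ?thesis using \<open>r > 0\<close> unfolding is_circle_def by blast
qed

text \<open>All orbits of type \<open>r/k\<close> are regular polygons or star polygons, and one of them has a vertex at \<open>\<gamma> s\<close>. The two
  sides that meet there have equal length, so the reflection law makes the sum of the chord vectors from
  \<open>\<gamma> s\<close>, which is a multiple of \<open>\<gamma> s\<close>, orthogonal to the tangent.\<close>

theorem circle_if_invariant_curve_of_periodic_orbits:
  assumes k: "k \<ge> 2" and inv: "rotation (2 * pi / real k) ` range \<gamma> = range \<gamma>"
    and C: "rotational_invariant_curve_of_periodic_orbits \<gamma> k C"
  shows "is_circle (range \<gamma>)"
proof (rule circle_if_radius_orthogonal)
  fix s
  have k0: "k > 0" using k by simp
  obtain X :: "real \<Rightarrow> nat \<Rightarrow> real" and r :: int and W :: real where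
    X: "\<And>a. periodic_configuration k (of_int r * l) (X a)"
    "\<And>i. continuous_on UNIV (\<lambda>a. X a i)"
    "\<And>a i. X (a + 1) i = X a i + W" "W \<noteq> 0"
    by (rule lifted_invariant_curve[OF k0 C], rule that)
  define c where "c = of_int r * l / real k"
  obtain w where w: "rotates w c"
    using rotates_length_div[OF k inv] unfolding c_def by blast
  have step: "X a (Suc i) = X a i + c" for a i
    unfolding c_def
    by (rule periodic_configuration_equidistant[OF _ X])
      (use k X(1) chord_cos_rotates[OF w[unfolded c_def]] in auto)
  \<comment> \<open>Starting one step before \<open>s\<close> puts the vertex at index \<open>1\<close>, where both neighbours are available.\<close>
  obtain a where a: "X a 0 = s - c"
    using loop_surj[OF X(2)[of 0] X(3,4)] by metis
  have st: "stationary (X a)" using X(1) by (simp add: periodic_configuration_def)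
  have xs: "X a (Suc 0) = s" "X a (Suc (Suc 0)) = s + c"
    using step[of a 0] step[of a "Suc 0"] a by simp_all
  have c: "0 < c" "c < l"
    and bounce: "chord_cos s (s + c) = - chord_cos s (s - c)"
    using st[unfolded stationary_def, rule_format, of 0] by (simp_all add: xs a)
  have nw: "norm w = 1" and rot: "\<gamma> (s + c) = w * \<gamma> s"
    using w by (auto simp: rotates_def)
  have rot': "\<gamma> (s - c) = cnj w * \<gamma> s"
  proof -
    have "\<gamma> s = w * \<gamma> (s - c)"
      using w[unfolded rotates_def, THEN conjunct2, rule_format, of "s - c"] by simp
    moreover have "cnj w * w = 1"
      using nw by (metis complex_norm_square mult.commute of_real_1 one_power2)
    ultimately show ?thesis by (metis mult.assoc mult_1)
  qed
  define m where "m = norm (\<gamma> (s + c) - \<gamma> s)"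
  have "m \<noteq> 0" using curve_neq[of s "s + c"] c by (simp add: m_def)
  have d: "\<gamma> (s + c) - \<gamma> s = (w - 1) * \<gamma> s" "\<gamma> (s - c) - \<gamma> s = (cnj w - 1) * \<gamma> s"
    by (simp_all add: rot rot' left_diff_distrib)
  have "norm (cnj w - 1) = norm (w - 1)"
    by (metis complex_cnj_diff complex_cnj_one complex_mod_cnj)
  then have m': "m = norm (\<gamma> (s - c) - \<gamma> s)"
    by (simp add: m_def d norm_mult)
  have "inner (\<gamma> (s + c) - \<gamma> s) (tangent s) + inner (\<gamma> (s - c) - \<gamma> s) (tangent s) = 0"
    using bounce \<open>m \<noteq> 0\<close> unfolding chord_cos_def m_def[symmetric] m'[symmetric]
    by (simp add: field_simps)
  moreover have "\<gamma> (s + c) - \<gamma> s + (\<gamma> (s - c) - \<gamma> s) = (2 * Re w - 2) *\<^sub>R \<gamma> s"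
    unfolding d by (simp add: complex_eq_iff algebra_simps)
  ultimately have "(2 * Re w - 2) * inner (\<gamma> s) (tangent s) = 0"
    by (metis inner_add_left inner_scaleR_left)
  moreover have "Re w \<noteq> 1"
  proof
    assume "Re w = 1"
    then have "w = 1" using nw by (simp add: cmod_def complex_eq_iff)
    then show False using \<open>m \<noteq> 0\<close> by (simp add: m_def d)
  qed
  ultimately show "inner (\<gamma> s) (tangent s) = 0" by simp
qed

end

theorem theorem1:
  fixes k :: nat and \<gamma> :: "real \<Rightarrow> complex" and l :: real
  assumes "k \<ge> 3"
    and "C2_closed_curve \<gamma> l"
    and "strictly_convex_curve (range \<gamma>)"
    and "rotation (2 * pi / real k) ` range \<gamma> = range \<gamma>"
    and "\<exists>C. rotational_invariant_curve_of_periodic_orbits \<gamma> k C"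
  shows "is_circle (range \<gamma>)"
proof -
  interpret billiard_table \<gamma> l by unfold_locales (use assms in auto)
  show ?thesis using circle_if_invariant_curve_of_periodic_orbits[of k] assms by auto
qed


end
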